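(* Suppose that (A1) $\sum_{i=1}^{\infty} w_i = \infty$ and $\sum_{i=1}^{\infty} w_i^2 < \infty$; (A5) there exists a constant $B<\infty$ such that, for every $\theta_1,\theta_2,\theta_3\in\Theta$, $$\int_{\mathcal{X}} \left(\frac{p(x|\theta_1)}{p(x|\theta_2)}\right)^2 p(x|\theta_3)\,\nu(dx) < B.$$ Then $K_n^*\to 0$ almost surely as $n\to\infty$.
   Context: Setting. For each $\theta\in\Theta$, $p(\cdot|\theta)$ is a known sampling density on $\mathcal{X}$ with respect to a dominating $\sigma$-finite measure $\nu$. The mixing distribution $F$ is a probability measure on $\Theta$, absolutely continuous with respect to a $\sigma$-finite measure $\mu$ on $\Theta$, with density $f=dF/d\mu$. The observations $X_1,X_2,\ldots$ are i.i.d. with density (with respect to $\nu$) $$p(x)=\int_\Theta p(x|\theta)f(\theta)\,\mu(d\theta).$$ Recursive estimate. Fix an initial estimate $f_0$ (a density on $\Theta$ with respect to $\mu$) and a sequence of weights $w_1,w_2,\ldots\in(0,1)$. For $i\ge 1$ define $$f_i(\theta)=(1-w_i)f_{i-1}(\theta)+w_i\,\frac{p(X_i|\theta)f_{i-1}(\theta)}{\int_\Theta p(X_i|\theta')f_{i-1}(\theta')\,\mu(d\theta')},\qquad \theta\in\Theta,$$ and let $$p_n(x)=\int_\Theta p(x|\theta)f_n(\theta)\,\mu(d\theta).$$ Kullback–Leibler error: $$K_n^*=\int_{\mathcal{X}} p\log(p/p_n)\,d\nu.$$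
   Formalization: It is additionally assumed that the initial density f_0 is positive μ-almost everywhere where f is positive (F is absolutely continuous with respect to F_0); without this the claim fails, e.g. for two parameters with f_0 concentrated on one and f on the other. *)

theory Defs
  imports "HOL-Probability.Probability"
begin

definition prob_density_on :: "'a measure \<Rightarrow> ('a \<Rightarrow> real) \<Rightarrow> bool" where
  "prob_density_on N f \<longleftrightarrow>
     f \<in> borel_measurable N \<and> (\<forall>x\<in>space N. 0 \<le> f x) \<and> (\<integral>\<^sup>+x. ennreal (f x) \<partial>N) = 1"

text \<open>Throughout, \<open>k x \<theta>\<close> stands for the sampling density \<open>p(x | \<theta>)\<close>. If \<open>f\<close> is a density, then by
  Tonelli the integral below is finite for almost every \<open>x\<close>, so the value \<open>0\<close> that the Bochner
  integral takes on a non-integrable argument only occurs on a null set of points \<open>x\<close>.\<close>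

definition mixture :: "'t measure \<Rightarrow> ('x \<Rightarrow> 't \<Rightarrow> real) \<Rightarrow> ('t \<Rightarrow> real) \<Rightarrow> 'x \<Rightarrow> real" where
  "mixture \<mu> k f x = (\<integral>\<theta>. k x \<theta> * f \<theta> \<partial>\<mu>)"

text \<open>The observations and the weights are indexed from \<open>1\<close>; their values at \<open>0\<close> are never used.\<close>

primrec recursive_estimate ::
  "'t measure \<Rightarrow> ('x \<Rightarrow> 't \<Rightarrow> real) \<Rightarrow> (nat \<Rightarrow> real) \<Rightarrow> ('t \<Rightarrow> real) \<Rightarrow> (nat \<Rightarrow> 'x) \<Rightarrow> nat \<Rightarrow> 't \<Rightarrow> real"
where
  "recursive_estimate \<mu> k w f0 xs 0 = f0"
| "recursive_estimate \<mu> k w f0 xs (Suc n) = (\<lambda>\<theta>.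
     (1 - w (Suc n)) * recursive_estimate \<mu> k w f0 xs n \<theta>
     + w (Suc n) * (k (xs (Suc n)) \<theta> * recursive_estimate \<mu> k w f0 xs n \<theta>
                    / mixture \<mu> k (recursive_estimate \<mu> k w f0 xs n) (xs (Suc n))))"

text \<open>\<open>kl_integrand a b\<close> is \<open>a log (a / b)\<close> for \<open>a, b \<ge> 0\<close>, with the usual conventions
  \<open>0 log (0 / b) = 0\<close> and \<open>a log (a / 0) = \<infinity>\<close> for \<open>a > 0\<close>.\<close>

definition kl_integrand :: "real \<Rightarrow> real \<Rightarrow> ereal" where
  "kl_integrand a b = (if a = 0 then 0 else if b = 0 then \<infinity> else ereal (a * ln (a / b)))"

text \<open>The integral of \<open>p log (p / q)\<close> as an extended real, namely the integral of the positive part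
  minus that of the negative part. The Bochner integral, and with it the library's
  \<open>KL_divergence\<close>, would return \<open>0\<close> where the Kullback--Leibler divergence is infinite. For
  densities \<open>p\<close> and \<open>q\<close> the negative part has integral at most \<open>1\<close>, so the difference is never
  \<open>\<infinity> - \<infinity>\<close>.\<close>

definition kl_error :: "'x measure \<Rightarrow> ('x \<Rightarrow> real) \<Rightarrow> ('x \<Rightarrow> real) \<Rightarrow> ereal" where
  "kl_error \<nu> p q =
     enn2ereal (\<integral>\<^sup>+x. e2ennreal (kl_integrand (p x) (q x)) \<partial>\<nu>)
     - enn2ereal (\<integral>\<^sup>+x. e2ennreal (- kl_integrand (p x) (q x)) \<partial>\<nu>)"

end

theory Submission imports Defs
begin

text \<open>
  The proof follows two Kullback--Leibler divergences along the recursion: the error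
  \<open>K n\<close> of the mixture \<open>p\<^sub>n\<close> relative to \<open>p\<close>, and the divergence of
  the true mixing density \<open>f\<close>, cut off to a set \<open>A\<close>, relative to the estimate
  \<open>f\<^sub>n\<close>. In both cases one observation replaces the second argument \<open>q\<close> by
  \<open>(1 - w) q + w r\<close> for a density \<open>r\<close>. Since \<open>ln (1 + u) \<ge> u - u\<^sup>2 / \<delta>\<close> for
  \<open>1 + u \<ge> \<delta>\<close>, such a step lowers the divergence by \<open>w (\<integral> p r / q - \<integral> p)\<close> up to an error of
  order \<open>w\<^sup>2\<close> (\<open>gen_kl_mixing_step\<close>). The ratio condition on the kernel passes from single
  parameters to mixtures by convexity (\<open>mixture_ratio_moment\<close>), so that the error is at most
  \<open>(B + 1) w\<^sup>2 / \<delta>\<close> in expectation, whatever the current estimate is.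

  For the mixtures, the expected first-order decrease is nonnegative by the Cauchy--Schwarz inequality
  (\<open>cross_moment_ge_1\<close>). Hence \<open>K n\<close> plus a constant multiple of the tail
  of \<open>\<Sum> w\<^sup>2\<close> is a nonnegative supermartingale.

  For the mixing densities, the expected first-order decrease per unit of weight is the chi-square divergence of
  \<open>p\<close> from \<open>p\<^sub>n\<close>, up to a loss of order \<open>F(A\<^sup>c)\<close>, and the
  chi-square divergence is at least \<open>K n\<close>. As the divergence that is being
  decreased is nonnegative and \<open>\<Sum> w = \<infinity>\<close>, the expectation of \<open>K n\<close> cannot stay
  above the loss. The cut-off is there because the divergence of \<open>f\<close> from \<open>f0\<close> may be
  infinite: on \<open>A = {f \<le> T f0}\<close> it is at most about \<open>ln T\<close>, and
  \<open>F(A\<^sup>c)\<close> vanishes as \<open>T\<close> grows. Together, the expectation of \<open>K n\<close>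
  tends to \<open>0\<close> (\<open>expected_KL_tendsto_0\<close>).

  A nonnegative supermartingale whose expectations tend to \<open>0\<close> tends to \<open>0\<close> almost surely by the
  maximal inequality (\<open>nonneg_supermartingale_AE_tendsto_0\<close>). This carries the
  convergence over from expectations to almost every sample.
\<close>

section \<open>The Kullback--Leibler divergence under mixing\<close>

text \<open>The summand is nonnegative wherever \<open>p > 0\<close> implies \<open>q > 0\<close>, so that a nonnegative integral
  can be used and infinite values are represented faithfully. For probability densities \<open>p\<close> and \<open>q\<close> it is the Kullback--Leibler
  divergence; for a density \<open>q\<close> and a subdensity \<open>p\<close> it differs from \<open>\<integral> p ln (p / q)\<close> by the
  constant \<open>1 - \<integral> p\<close>.\<close>

definition gen_kl :: "'a measure \<Rightarrow> ('a \<Rightarrow> real) \<Rightarrow> ('a \<Rightarrow> real) \<Rightarrow> ennreal" where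
  "gen_kl N p q = (\<integral>\<^sup>+x. ennreal (p x * ln (p x / q x) - p x + q x) \<partial>N)"

lemma le_square_plus_1: "(t :: real) \<le> t\<^sup>2 + 1"
proof -
  have "2 * t \<le> t\<^sup>2 + 1" using zero_le_power2[of "t - 1"] unfolding power2_diff by simp
  with zero_le_power2[of t] show ?thesis by linarith
qed

text \<open>This is \<open>1 - 1 / y \<le> ln y\<close> at \<open>y = 1 + u\<close>. Asking for a lower bound on
  \<open>1 + u\<close> instead of a small \<open>u\<close> makes it applicable to every weight \<open>w \<le> 1 - \<delta>\<close>.\<close>

lemma ln_ge_linear_minus_square:
  fixes u \<delta> :: real
  assumes "0 < \<delta>" "\<delta> \<le> 1 + u"
  shows "u - u\<^sup>2 / \<delta> \<le> ln (1 + u)"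
proof -
  have pos: "0 < 1 + u" using assms by linarith
  have "u\<^sup>2 / (1 + u) \<le> u\<^sup>2 / \<delta>"
    using assms by (intro divide_left_mono) auto
  moreover have "1 - 1 / (1 + u) \<le> ln (1 + u)"
    using ln_le_minus_one[of "1 / (1 + u)"] pos by (simp add: ln_div)
  moreover have "1 - 1 / (1 + u) = u - u\<^sup>2 / (1 + u)"
    using pos by (simp add: field_simps power2_eq_square)
  ultimately show ?thesis by linarith
qed

lemma kl_summand_nonneg:
  fixes a b :: real
  assumes "0 \<le> a" "0 \<le> b" "0 < a \<longrightarrow> 0 < b"
  shows "0 \<le> a * ln (a / b) - a + b"
proof (cases "a = 0")
  case False
  with assms have ab: "0 < a" "0 < b" by auto
  have "ln (b / a) \<le> b / a - 1" using ab by (intro ln_le_minus_one) auto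
  then have "a * ln (b / a) \<le> a * (b / a - 1)" using ab by (intro mult_left_mono) auto
  also have "\<dots> = b - a" using ab by (simp add: field_simps)
  finally show ?thesis using ab by (simp add: ln_div algebra_simps)
qed (use assms in auto)

lemma kl_summand_le_chi_square:
  fixes a b :: real
  assumes "0 \<le> a" "0 \<le> b" "0 < a \<longrightarrow> 0 < b"
  shows "a * ln (a / b) - a + b \<le> a\<^sup>2 / b - 2 * a + b"
proof (cases "a = 0")
  case False
  with assms have ab: "0 < a" "0 < b" by auto
  have "ln (a / b) \<le> a / b - 1" using ab by (intro ln_le_minus_one) auto
  then have "a * ln (a / b) \<le> a * (a / b - 1)" using ab by (intro mult_left_mono) auto
  also have "\<dots> = a\<^sup>2 / b - a" by (simp add: field_simps power2_eq_square)
  finally show ?thesis by simp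
qed (use assms in auto)

text \<open>Where \<open>p > 0\<close> put \<open>u = w (r / q - 1)\<close>, so that \<open>q' = q (1 + u)\<close> and \<open>1 + u \<ge> 1 - w \<ge> \<delta>\<close>.
  Then \<open>p ln (p / q') = p ln (p / q) - p ln (1 + u)\<close>, and \<open>ln (1 + u) \<ge> u - u\<^sup>2 / \<delta>\<close>. The gain
  \<open>w \<integral> p r / q\<close> stands on the left to avoid subtraction of extended reals. The summands \<open>q\<close> and \<open>q'\<close> of
  the two divergences cancel because both have integral \<open>1\<close>.\<close>

lemma gen_kl_mixing_step:
  fixes p q q' r :: "'a \<Rightarrow> real" and w \<delta> :: real
  assumes [measurable]: "p \<in> borel_measurable N" "q \<in> borel_measurable N"
      "q' \<in> borel_measurable N" "r \<in> borel_measurable N"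
    and nonneg: "\<And>x. x \<in> space N \<Longrightarrow> 0 \<le> p x" "\<And>x. x \<in> space N \<Longrightarrow> 0 \<le> q x"
      "\<And>x. x \<in> space N \<Longrightarrow> 0 \<le> r x"
    and supp: "AE x in N. 0 < p x \<longrightarrow> 0 < q x"
    and w: "0 < \<delta>" "0 \<le> w" "w \<le> 1 - \<delta>"
    and q': "AE x in N. q' x = (1 - w) * q x + w * r x"
    and q_int: "(\<integral>\<^sup>+x. ennreal (q x) \<partial>N) = 1" and r_int: "(\<integral>\<^sup>+x. ennreal (r x) \<partial>N) = 1"
  shows "gen_kl N p q' + ennreal w * (\<integral>\<^sup>+x. ennreal (p x * r x / q x) \<partial>N)
    \<le> gen_kl N p q + ennreal w * (\<integral>\<^sup>+x. ennreal (p x) \<partial>N)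
       + ennreal (w\<^sup>2 / \<delta>) * (\<integral>\<^sup>+x. ennreal (p x * ((r x / q x)\<^sup>2 + 1)) \<partial>N)"
proof -
  let ?a = "\<lambda>x. p x * ln (p x / q' x) - p x + q' x"
  let ?b = "\<lambda>x. p x * ln (p x / q x) - p x + q x"
  have AE_sp: "AE x in N. x \<in> space N" by (rule AE_space)
  have pt: "ennreal (?a x) + ennreal w * ennreal (p x * r x / q x) + ennreal (q x)
      \<le> ennreal (?b x) + ennreal w * ennreal (p x)
        + ennreal (w\<^sup>2 / \<delta>) * ennreal (p x * ((r x / q x)\<^sup>2 + 1)) + ennreal (q' x)"
    if x: "x \<in> space N" and s: "0 < p x \<longrightarrow> 0 < q x" and e: "q' x = (1 - w) * q x + w * r x" for x
  proof -
    note n = nonneg[OF x]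
    have w1: "0 < 1 - w" using w by linarith
    have q'0: "0 \<le> q' x" using e n w w1 by simp
    have s': "0 < p x \<longrightarrow> 0 < q' x"
      using s e n w w1 by (auto intro!: add_pos_nonneg mult_pos_pos)
    have a0: "0 \<le> ?a x" by (rule kl_summand_nonneg[OF n(1) q'0 s'])
    have b0: "0 \<le> ?b x" by (rule kl_summand_nonneg[OF n(1) n(2) s])
    have main: "?a x + w * (p x * r x / q x) + q x
      \<le> ?b x + w * p x + w\<^sup>2 / \<delta> * (p x * ((r x / q x)\<^sup>2 + 1)) + q' x"
    proof (cases "p x = 0")
      case False
      then have p: "0 < p x" using n by simp
      with s s' have q: "0 < q x" "0 < q' x" by auto
      define t where "t = r x / q x"
      define u where "u = w * (t - 1)"
      have t0: "0 \<le> t" using n by (simp add: t_def)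
      have ratio: "q' x = q x * (1 + u)"
        using q by (simp add: e u_def t_def field_simps)
      have "w * t \<ge> 0" using w t0 by simp
      then have u1: "\<delta> \<le> 1 + u" using w by (simp add: u_def algebra_simps)
      have u0: "0 < 1 + u" using u1 w by linarith
      have "u\<^sup>2 \<le> w\<^sup>2 * (t\<^sup>2 + 1)"
        unfolding u_def power_mult_distrib using t0
        by (intro mult_left_mono) (auto simp: power2_eq_square algebra_simps)
      then have "u\<^sup>2 / \<delta> \<le> w\<^sup>2 * (t\<^sup>2 + 1) / \<delta>" using w by (intro divide_right_mono) auto
      moreover have "u - u\<^sup>2 / \<delta> \<le> ln (1 + u)" by (rule ln_ge_linear_minus_square) (use w u1 in auto)
      ultimately have "u - w\<^sup>2 * (t\<^sup>2 + 1) / \<delta> \<le> ln (1 + u)" by linarith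
      then have "p x * (u - w\<^sup>2 * (t\<^sup>2 + 1) / \<delta>) \<le> p x * ln (1 + u)"
        using p by (intro mult_left_mono) auto
      moreover have "p x * ln (p x / q' x) = p x * ln (p x / q x) - p x * ln (1 + u)"
      proof -
        have "ln (q' x) = ln (q x) + ln (1 + u)" unfolding ratio using q u0 by (simp add: ln_mult)
        then show ?thesis using p q by (simp add: ln_div algebra_simps)
      qed
      ultimately show ?thesis
        unfolding t_def[symmetric] times_divide_eq_right[symmetric]
        by (simp add: u_def algebra_simps add_divide_distrib)
    qed (use n q'0 in auto)
    have "ennreal (?a x) + ennreal w * ennreal (p x * r x / q x) + ennreal (q x)
        = ennreal (?a x + w * (p x * r x / q x) + q x)"
    proof -
      have "ennreal a + ennreal w * ennreal b + ennreal c = ennreal (a + w * b + c)"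
        if "0 \<le> a" "0 \<le> b" "0 \<le> c" for a b c
        using that w by (simp add: ennreal_mult ennreal_plus)
      then show ?thesis using a0 n by simp
    qed
    also have "\<dots> \<le> ennreal (?b x + w * p x + w\<^sup>2 / \<delta> * (p x * ((r x / q x)\<^sup>2 + 1)) + q' x)"
      by (rule ennreal_leI[OF main])
    also have "\<dots> = ennreal (?b x) + ennreal w * ennreal (p x)
        + ennreal (w\<^sup>2 / \<delta>) * ennreal (p x * ((r x / q x)\<^sup>2 + 1)) + ennreal (q' x)"
    proof -
      have "ennreal (a + w * b + w\<^sup>2 / \<delta> * c + d)
          = ennreal a + ennreal w * ennreal b + ennreal (w\<^sup>2 / \<delta>) * ennreal c + ennreal d"
        if "0 \<le> a" "0 \<le> b" "0 \<le> c" "0 \<le> d" for a b c d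
        using that w by (simp add: ennreal_mult[symmetric] ennreal_plus[symmetric] del: ennreal_plus)
      from this[of "?b x" "p x" "p x * ((r x / q x)\<^sup>2 + 1)" "q' x"] show ?thesis
        using b0 n q'0 by simp
    qed
    finally show ?thesis .
  qed
  have q'_int: "(\<integral>\<^sup>+x. ennreal (q' x) \<partial>N) = 1"
  proof -
    have "(\<integral>\<^sup>+x. ennreal (q' x) \<partial>N) = (\<integral>\<^sup>+x. ennreal (1 - w) * ennreal (q x) + ennreal w * ennreal (r x) \<partial>N)"
    proof (rule nn_integral_cong_AE, use AE_sp q' in eventually_elim)
      fix x assume "x \<in> space N" "q' x = (1 - w) * q x + w * r x"
      then show "ennreal (q' x) = ennreal (1 - w) * ennreal (q x) + ennreal w * ennreal (r x)"
        using nonneg[of x] w by (simp add: ennreal_plus ennreal_mult)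
    qed
    also have "\<dots> = ennreal (1 - w) + ennreal w"
      by (subst nn_integral_add) (auto simp: nn_integral_cmult q_int r_int)
    also have "\<dots> = 1" using w by (simp flip: ennreal_plus)
    finally show ?thesis .
  qed
  have "(\<integral>\<^sup>+x. ennreal (?a x) + ennreal w * ennreal (p x * r x / q x) + ennreal (q x) \<partial>N)
     \<le> (\<integral>\<^sup>+x. ennreal (?b x) + ennreal w * ennreal (p x)
        + ennreal (w\<^sup>2 / \<delta>) * ennreal (p x * ((r x / q x)\<^sup>2 + 1)) + ennreal (q' x) \<partial>N)"
    by (rule nn_integral_mono_AE, use AE_sp supp q' in eventually_elim) (rule pt)
  then have "gen_kl N p q' + ennreal w * (\<integral>\<^sup>+x. ennreal (p x * r x / q x) \<partial>N) + 1
    \<le> gen_kl N p q + ennreal w * (\<integral>\<^sup>+x. ennreal (p x) \<partial>N)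
       + ennreal (w\<^sup>2 / \<delta>) * (\<integral>\<^sup>+x. ennreal (p x * ((r x / q x)\<^sup>2 + 1)) \<partial>N) + 1"
    by (simp add: nn_integral_add nn_integral_cmult q_int q'_int gen_kl_def)
  then show ?thesis
    by (subst (asm) (1 2) add.commute[of _ 1]) (simp add: ennreal_add_left_cancel_le)
qed

text \<open>This is \<open>ln y \<le> y - 1\<close>; the right-hand side is \<open>1\<close> plus the chi-square divergence.\<close>

lemma gen_kl_le_chi_square:
  assumes [measurable]: "p \<in> borel_measurable N" "q \<in> borel_measurable N"
    and nonneg: "\<And>x. x \<in> space N \<Longrightarrow> 0 \<le> p x" "\<And>x. x \<in> space N \<Longrightarrow> 0 \<le> q x"
    and supp: "AE x in N. 0 < p x \<longrightarrow> 0 < q x"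
    and p_int: "(\<integral>\<^sup>+x. ennreal (p x) \<partial>N) = 1" and q_int: "(\<integral>\<^sup>+x. ennreal (q x) \<partial>N) = 1"
  shows "gen_kl N p q + 1 \<le> (\<integral>\<^sup>+x. ennreal ((p x)\<^sup>2 / q x) \<partial>N)"
proof -
  let ?b = "\<lambda>x. p x * ln (p x / q x) - p x + q x"
  have "(\<integral>\<^sup>+x. ennreal (?b x) + 2 * ennreal (p x) \<partial>N) \<le> (\<integral>\<^sup>+x. ennreal ((p x)\<^sup>2 / q x) + ennreal (q x) \<partial>N)"
  proof (rule nn_integral_mono_AE, use AE_space supp in eventually_elim)
    fix x assume x: "x \<in> space N" and s: "0 < p x \<longrightarrow> 0 < q x"
    note n = nonneg[OF x]
    have "ennreal (?b x + 2 * p x) = ennreal (?b x) + ennreal (2 * p x)"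
      by (rule ennreal_plus) (use kl_summand_nonneg[OF n s] n in auto)
    then have "ennreal (?b x) + 2 * ennreal (p x) = ennreal (?b x + 2 * p x)"
      using n by (simp add: ennreal_mult)
    also have "\<dots> \<le> ennreal ((p x)\<^sup>2 / q x + q x)"
      using kl_summand_le_chi_square[OF n s] by (intro ennreal_leI) linarith
    also have "\<dots> = ennreal ((p x)\<^sup>2 / q x) + ennreal (q x)" using n by (simp add: ennreal_plus)
    finally show "ennreal (?b x) + 2 * ennreal (p x) \<le> ennreal ((p x)\<^sup>2 / q x) + ennreal (q x)" .
  qed
  then have "gen_kl N p q + 2 \<le> (\<integral>\<^sup>+x. ennreal ((p x)\<^sup>2 / q x) \<partial>N) + 1"
    by (simp add: nn_integral_add nn_integral_cmult p_int q_int gen_kl_def)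
  then have "1 + (gen_kl N p q + 1) \<le> 1 + (\<integral>\<^sup>+x. ennreal ((p x)\<^sup>2 / q x) \<partial>N)"
    by (simp add: ac_simps flip: one_add_one)
  then show ?thesis by (simp only: ennreal_add_left_cancel_le) simp
qed

text \<open>The negative part of \<open>p ln (p / q)\<close> is at most \<open>q\<close>. Its integral is therefore finite, so
  it can be subtracted from the integral of the positive part, and \<open>p\<close> and \<open>q\<close> cancel.\<close>

lemma kl_error_eq_gen_kl:
  assumes [measurable]: "p \<in> borel_measurable N" "q \<in> borel_measurable N"
    and nonneg: "\<And>x. x \<in> space N \<Longrightarrow> 0 \<le> p x" "\<And>x. x \<in> space N \<Longrightarrow> 0 \<le> q x"
    and supp: "AE x in N. 0 < p x \<longrightarrow> 0 < q x"
    and p_int: "(\<integral>\<^sup>+x. ennreal (p x) \<partial>N) = 1" and q_int: "(\<integral>\<^sup>+x. ennreal (q x) \<partial>N) = 1"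
  shows "kl_error N p q = enn2ereal (gen_kl N p q)"
proof -
  let ?b = "\<lambda>x. p x * ln (p x / q x)"
  have eq: "kl_integrand (p x) (q x) = ereal (?b x)"
    if "x \<in> space N" "0 < p x \<longrightarrow> 0 < q x" for x
    using that nonneg[of x] by (auto simp: kl_integrand_def)
  define U where "U = (\<integral>\<^sup>+x. ennreal (?b x) \<partial>N)"
  define L where "L = (\<integral>\<^sup>+x. ennreal (- ?b x) \<partial>N)"
  have U: "(\<integral>\<^sup>+x. e2ennreal (kl_integrand (p x) (q x)) \<partial>N) = U"
    unfolding U_def
    by (rule nn_integral_cong_AE, use AE_space supp in eventually_elim) (auto simp: eq)
  have L: "(\<integral>\<^sup>+x. e2ennreal (- kl_integrand (p x) (q x)) \<partial>N) = L"
    unfolding L_def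
    by (rule nn_integral_cong_AE, use AE_space supp in eventually_elim) (auto simp: eq)
  have "(\<integral>\<^sup>+x. ennreal (?b x - p x + q x) + ennreal (- ?b x) + ennreal (p x) \<partial>N)
      = (\<integral>\<^sup>+x. ennreal (?b x) + ennreal (q x) \<partial>N)"
  proof (rule nn_integral_cong_AE, use AE_space supp in eventually_elim)
    fix x assume x: "x \<in> space N" and s: "0 < p x \<longrightarrow> 0 < q x"
    note n = nonneg[OF x] and k = kl_summand_nonneg[OF nonneg[OF x] s]
    show "ennreal (?b x - p x + q x) + ennreal (- ?b x) + ennreal (p x) = ennreal (?b x) + ennreal (q x)"
    proof (cases "0 \<le> ?b x")
      case True
      then have "ennreal (- ?b x) = 0" by (intro ennreal_neg) simp
      then show ?thesis using True k n by (simp flip: ennreal_plus)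
    next
      case False
      then have "ennreal (?b x) = 0" by (intro ennreal_neg) simp
      then show ?thesis using False k n by (simp flip: ennreal_plus)
    qed
  qed
  then have sum: "gen_kl N p q + L + 1 = U + 1"
    by (simp add: nn_integral_add gen_kl_def U_def L_def p_int q_int)
  have "L \<le> (\<integral>\<^sup>+x. ennreal (q x) \<partial>N)"
    unfolding L_def
  proof (rule nn_integral_mono_AE, use AE_space supp in eventually_elim)
    fix x assume x: "x \<in> space N" and s: "0 < p x \<longrightarrow> 0 < q x"
    show "ennreal (- ?b x) \<le> ennreal (q x)"
      using kl_summand_nonneg[OF nonneg[OF x] s] nonneg[OF x] by (intro ennreal_leI) linarith
  qed
  then have Lfin: "L < top" by (simp add: q_int le_less_trans[OF _ ennreal_one_less_top])
  have "U = gen_kl N p q + L"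
    using sum by (metis add.commute ennreal_add_left_cancel ennreal_one_neq_top infinity_ennreal_def)
  then have "enn2ereal U = enn2ereal (gen_kl N p q) + enn2ereal L"
    by (simp add: plus_ennreal.rep_eq)
  moreover have "\<bar>enn2ereal L\<bar> \<noteq> \<infinity>" using Lfin by (cases L) (auto simp: enn2ereal_ennreal)
  ultimately have "enn2ereal U - enn2ereal L = enn2ereal (gen_kl N p q)"
    by (cases "enn2ereal L"; cases "enn2ereal (gen_kl N p q)") auto
  then show ?thesis unfolding kl_error_def U L .
qed

section \<open>Nonnegative supermartingales with vanishing expectation\<close>

text \<open>Ville's inequality. Let \<open>H n\<close> be the event that the level \<open>\<epsilon>\<close> has been reached by time
  \<open>m + n\<close>. Then \<open>\<epsilon> P (H n)\<close> plus the expectation of \<open>V (m + n)\<close> off \<open>H n\<close> does not increase with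
  \<open>n\<close>: the newly reached part has \<open>V \<ge> \<epsilon>\<close>, and the rest obeys the supermartingale property.
  Stating that property through integrals over events of \<open>F n\<close> lets \<open>V\<close> take the
  value \<open>\<infinity>\<close>.\<close>

lemma nonneg_supermartingale_maximal_inequality:
  fixes V :: "nat \<Rightarrow> 'a \<Rightarrow> ennreal" and F :: "nat \<Rightarrow> 'a measure"
  assumes sub: "\<And>n. subalgebra M (F n)" and filt: "\<And>n. subalgebra (F (Suc n)) (F n)"
    and meas: "\<And>n. V n \<in> borel_measurable (F n)"
    and super: "\<And>n A. A \<in> sets (F n) \<Longrightarrow>
      (\<integral>\<^sup>+x. V (Suc n) x * indicator A x \<partial>M) \<le> (\<integral>\<^sup>+x. V n x * indicator A x \<partial>M)"
  shows "\<epsilon> * emeasure M {x \<in> space M. \<exists>j. V (m + j) x \<ge> \<epsilon>} \<le> (\<integral>\<^sup>+x. V m x \<partial>M)"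
proof -
  have spF: "space (F n) = space M" for n using sub[of n] by (simp add: subalgebra_def)
  have setsF: "sets (F n) \<subseteq> sets M" for n using sub[of n] by (simp add: subalgebra_def)
  have measM[measurable]: "V n \<in> borel_measurable M" for n
    using meas[of n] sub[of n] by (rule measurable_from_subalg[rotated])
  define H where "H n = {x \<in> space M. \<exists>j\<le>n. V (m + j) x \<ge> \<epsilon>}" for n
  have filt_le: "subalgebra (F (n + i)) (F n)" for n i
  proof (induction i)
    case 0 then show ?case by (simp add: subalgebra_def)
  next
    case (Suc i) then show ?case using filt[of "n + i"] by (auto simp: subalgebra_def)
  qed
  have V_meas: "V (m + j) \<in> borel_measurable (F (m + n))" if "j \<le> n" for j n
  proof (rule measurable_from_subalg[OF _ meas])
    show "subalgebra (F (m + n)) (F (m + j))" using filt_le[of "m + j" "n - j"] that by simp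
  qed
  have H_meas: "H n \<in> sets (F (m + n))" for n
  proof -
    have "{x \<in> space (F (m + n)). \<exists>j\<in>{..n}. \<epsilon> \<le> V (m + j) x} \<in> sets (F (m + n))"
    proof (rule sets.sets_Collect_finite_Ex)
      fix j assume "j \<in> {..n}"
      then show "{x \<in> space (F (m + n)). \<epsilon> \<le> V (m + j) x} \<in> sets (F (m + n))"
        by (intro borel_measurable_le borel_measurable_const V_meas) simp
    qed simp
    then show ?thesis unfolding H_def spF by (simp only: Bex_def atMost_iff)
  qed
  have H_sets[measurable]: "H n \<in> sets M" for n by (rule subsetD[OF setsF H_meas])
  have bound: "\<epsilon> * emeasure M (H n) + (\<integral>\<^sup>+x. V (m + n) x * indicator (space M - H n) x \<partial>M)
      \<le> (\<integral>\<^sup>+x. V m x \<partial>M)" for n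
  proof (induction n)
    case 0
    have "\<epsilon> * emeasure M (H 0) + (\<integral>\<^sup>+x. V (m + 0) x * indicator (space M - H 0) x \<partial>M)
       = (\<integral>\<^sup>+x. \<epsilon> * indicator (H 0) x + V m x * indicator (space M - H 0) x \<partial>M)"
      by (subst nn_integral_add) (auto simp: nn_integral_cmult)
    also have "\<dots> \<le> (\<integral>\<^sup>+x. V m x \<partial>M)"
      by (intro nn_integral_mono) (auto simp: H_def indicator_def)
    finally show ?case .
  next
    case (Suc n)
    let ?D = "H (Suc n) - H n"
    have sub_H: "H n \<subseteq> H (Suc n)" by (auto simp: H_def intro: le_SucI)
    have D: "\<epsilon> \<le> V (Suc (m + n)) x" if "x \<in> ?D" for x
      using that by (auto simp: H_def le_Suc_eq)
    have "\<epsilon> * emeasure M (H (Suc n)) = \<epsilon> * emeasure M (H n) + \<epsilon> * emeasure M ?D"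
    proof -
      have "H n \<union> ?D = H (Suc n)" using sub_H by blast
      then have "emeasure M (H n) + emeasure M ?D = emeasure M (H (Suc n))"
        using plus_emeasure[of "H n" M ?D] by auto
      then show ?thesis by (metis distrib_left)
    qed
    then have "\<epsilon> * emeasure M (H (Suc n)) + (\<integral>\<^sup>+x. V (m + Suc n) x * indicator (space M - H (Suc n)) x \<partial>M)
      = \<epsilon> * emeasure M (H n) + (\<integral>\<^sup>+x. \<epsilon> * indicator ?D x + V (Suc (m + n)) x * indicator (space M - H (Suc n)) x \<partial>M)"
      by (subst nn_integral_add) (auto simp: nn_integral_cmult add.assoc)
    also have "\<dots> \<le> \<epsilon> * emeasure M (H n) + (\<integral>\<^sup>+x. V (Suc (m + n)) x * indicator (space M - H n) x \<partial>M)"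
      using D sub_H by (intro add_left_mono nn_integral_mono) (auto simp: indicator_def split: if_splits)
    also have "\<dots> \<le> \<epsilon> * emeasure M (H n) + (\<integral>\<^sup>+x. V (m + n) x * indicator (space M - H n) x \<partial>M)"
      by (intro add_left_mono super) (metis H_meas sets.compl_sets spF)
    also note Suc
    finally show ?case .
  qed
  have "(SUP n. \<epsilon> * emeasure M (H n)) \<le> (\<integral>\<^sup>+x. V m x \<partial>M)"
  proof (rule SUP_least)
    fix n
    show "\<epsilon> * emeasure M (H n) \<le> (\<integral>\<^sup>+x. V m x \<partial>M)"
      by (rule order_trans[OF _ bound[of n]]) simp
  qed
  moreover have "(SUP n. \<epsilon> * emeasure M (H n)) = \<epsilon> * emeasure M (\<Union>n. H n)"
    by (subst SUP_mult_left_ennreal[symmetric], subst SUP_emeasure_incseq)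
      (auto simp: incseq_def H_def intro: order_trans)
  moreover have "(\<Union>n. H n) = {x \<in> space M. \<exists>j. V (m + j) x \<ge> \<epsilon>}"
    by (auto simp: H_def)
  ultimately show ?thesis by simp
qed

text \<open>For every \<open>m\<close>, the maximal inequality bounds the probability that \<open>V\<close> exceeds \<open>\<epsilon>\<close> infinitely
  often by the expectation of \<open>V m\<close> divided by \<open>\<epsilon>\<close>.\<close>

lemma nonneg_supermartingale_AE_tendsto_0:
  fixes V :: "nat \<Rightarrow> 'a \<Rightarrow> ennreal" and F :: "nat \<Rightarrow> 'a measure"
  assumes sub: "\<And>n. subalgebra M (F n)" and filt: "\<And>n. subalgebra (F (Suc n)) (F n)"
    and meas: "\<And>n. V n \<in> borel_measurable (F n)"
    and super: "\<And>n A. A \<in> sets (F n) \<Longrightarrow>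
      (\<integral>\<^sup>+x. V (Suc n) x * indicator A x \<partial>M) \<le> (\<integral>\<^sup>+x. V n x * indicator A x \<partial>M)"
    and lim: "(\<lambda>n. \<integral>\<^sup>+x. V n x \<partial>M) \<longlonglongrightarrow> 0"
  shows "AE x in M. (\<lambda>n. V n x) \<longlonglongrightarrow> 0"
proof -
  have measM[measurable]: "V n \<in> borel_measurable M" for n
    using meas[of n] sub[of n] by (rule measurable_from_subalg[rotated])
  have eps: "AE x in M. \<exists>m. \<forall>j. V (m + j) x < \<epsilon>" if e: "\<epsilon> = ennreal (1 / real (Suc i))" for i \<epsilon>
  proof -
    define N where "N = {x \<in> space M. \<forall>m. \<exists>j. V (m + j) x \<ge> \<epsilon>}"
    have "\<epsilon> * emeasure M N \<le> (\<integral>\<^sup>+x. V m x \<partial>M)" for m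
    proof -
      have "emeasure M N \<le> emeasure M {x \<in> space M. \<exists>j. V (m + j) x \<ge> \<epsilon>}"
        by (intro emeasure_mono) (auto simp: N_def)
      then show ?thesis
        using nonneg_supermartingale_maximal_inequality[where V = V and F = F and m = m and \<epsilon> = \<epsilon>,
          OF sub filt meas super] by (meson mult_left_mono order_trans zero_le)
    qed
    then have "\<epsilon> * emeasure M N \<le> 0" by (intro LIMSEQ_le_const[OF lim]) auto
    moreover have "\<epsilon> \<noteq> 0" using e by simp
    ultimately have "emeasure M N = 0" by simp
    moreover have "N \<in> sets M" unfolding N_def by measurable
    ultimately have "AE x in M. x \<notin> N" by (intro AE_not_in) auto
    then show ?thesis by (auto simp: N_def not_le)
  qed
  have "AE x in M. \<forall>i. \<exists>m. \<forall>j. V (m + j) x < ennreal (1 / real (Suc i))"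
    unfolding AE_all_countable using eps by blast
  then show ?thesis
  proof eventually_elim
    case (elim x)
    show ?case
    proof (rule order_tendstoI)
      fix a :: ennreal assume "0 < a"
      obtain i where i: "ennreal (1 / real (Suc i)) < a"
      proof (cases a)
        case (real r)
        with \<open>0 < a\<close> have "0 < r" by simp
        then obtain i where "inverse (real (Suc i)) < r" using reals_Archimedean by blast
        then have "ennreal (1 / real (Suc i)) < a"
          using real by (simp add: ennreal_less_iff inverse_eq_divide)
        then show ?thesis by (rule that)
      next
        case top then show ?thesis by (intro that[of 0]) simp
      qed
      obtain m where "\<forall>j. V (m + j) x < ennreal (1 / real (Suc i))" using elim by blast
      then have "\<forall>n\<ge>m. V n x < a" using i by (metis le_iff_add less_trans)
      then show "eventually (\<lambda>n. V n x < a) sequentially" by (auto simp: eventually_sequentially)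
    qed simp
  qed
qed

text \<open>By \<open>almost_decr\<close> the sequence \<open>e\<close> has a limit \<open>l \<ge> 0\<close>. If \<open>l\<close> were positive, then
  \<open>dissip\<close> for \<open>\<epsilon> = l / 4\<close> would eventually lower \<open>d\<close> by \<open>w n * l / 4\<close> in each step, up to a summable
  error, and the divergence of \<open>\<Sum> w\<close> would drive the nonnegative \<open>d\<close> to \<open>-\<infinity>\<close>. The potential
  \<open>d\<close> may depend on \<open>\<epsilon>\<close>.\<close>

lemma tendsto_0_of_dissipation:
  fixes e w :: "nat \<Rightarrow> real"
  assumes e0: "\<And>n. 0 \<le> e n" and w0: "\<And>n. 0 \<le> w n" and C: "0 \<le> C"
    and w_sq: "summable (\<lambda>n. (w n)\<^sup>2)"
    and w_div: "filterlim (\<lambda>n. \<Sum>i<n. w i) at_top sequentially"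
    and almost_decr: "\<And>n. e (Suc n) \<le> e n + C * (w n)\<^sup>2"
    and dissip: "\<And>\<epsilon>. 0 < \<epsilon> \<Longrightarrow> \<exists>d. (\<forall>n. 0 \<le> d n) \<and>
      (\<forall>n. d (Suc n) + w n * e n \<le> d n + w n * \<epsilon> + C * (w n)\<^sup>2)"
  shows "e \<longlonglongrightarrow> 0"
proof -
  define S where "S n = (\<Sum>i<n. (w i)\<^sup>2)" for n
  define T where "T = (\<Sum>i. (w i)\<^sup>2)"
  have S_lim: "S \<longlonglongrightarrow> T" unfolding S_def T_def by (rule summable_LIMSEQ[OF w_sq])
  have S_le: "S n \<le> T" for n unfolding S_def T_def by (rule sum_le_suminf[OF w_sq]) auto
  have "decseq (\<lambda>n. e n - C * S n)"
    by (rule decseq_SucI) (use almost_decr in \<open>auto simp: S_def algebra_simps\<close>)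
  moreover have "- (C * T) \<le> e n - C * S n" for n
    using mult_left_mono[OF S_le[of n] C] e0[of n] by linarith
  ultimately obtain L where L: "(\<lambda>n. e n - C * S n) \<longlonglongrightarrow> L"
    using decseq_convergent[of "\<lambda>n. e n - C * S n" "- (C * T)"] by metis
  define l where "l = L + C * T"
  have e_lim: "e \<longlonglongrightarrow> l"
    using tendsto_add[OF L tendsto_mult[OF tendsto_const[of C] S_lim]] by (simp add: l_def)
  have "l \<ge> 0" by (rule LIMSEQ_le_const[OF e_lim]) (use e0 in auto)
  moreover have "\<not> 0 < l"
  proof
    assume l: "0 < l"
    then obtain d where d0: "\<And>n. 0 \<le> d n"
      and d: "\<And>n. d (Suc n) + w n * e n \<le> d n + w n * (l / 4) + C * (w n)\<^sup>2"
      using dissip[of "l / 4"] by auto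
    have "\<forall>\<^sub>F n in sequentially. l / 2 < e n" by (rule order_tendstoD[OF e_lim]) (use l in simp)
    then obtain N where N: "\<And>n. n \<ge> N \<Longrightarrow> l / 2 < e n" by (auto simp: eventually_sequentially)
    have step: "d n + l / 4 * (\<Sum>i<n. w i) - C * S n \<le> d N + l / 4 * (\<Sum>i<N. w i) - C * S N"
      if "n \<ge> N" for n using that
    proof (induction n rule: dec_induct)
      case (step n)
      have "w n * (l / 2) \<le> w n * e n" using N[of n] step w0 by (intro mult_left_mono) auto
      then have "d (Suc n) + w n * (l / 4) \<le> d n + C * (w n)\<^sup>2" using d[of n] by (simp add: algebra_simps)
      then show ?case using step.IH by (simp add: S_def algebra_simps)
    qed simp
    define K where "K = d N + l / 4 * (\<Sum>i<N. w i) - C * S N + C * T"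
    have "l / 4 * (\<Sum>i<n. w i) \<le> K" if "n \<ge> N" for n
      using step[OF that] d0[of n] mult_left_mono[OF S_le[of n] C] by (simp add: K_def)
    then have ub: "(\<Sum>i<n. w i) \<le> 4 * K / l" if "n \<ge> N" for n
      using that l by (simp add: field_simps)
    have "\<forall>\<^sub>F n in sequentially. 4 * K / l < (\<Sum>i<n. w i)"
      using w_div by (simp add: filterlim_at_top_dense)
    then obtain n where "n \<ge> N" "4 * K / l < (\<Sum>i<n. w i)"
      unfolding eventually_sequentially by (meson linear order_refl)
    with ub[of n] show False by linarith
  qed
  ultimately show ?thesis using e_lim by (metis less_eq_real_def)
qed

section \<open>Ratio moments of mixtures\<close>

lemma (in prob_space) square_nn_integral_le:
  fixes u :: "'a \<Rightarrow> ennreal"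
  assumes [measurable]: "u \<in> borel_measurable M"
  shows "(\<integral>\<^sup>+x. u x \<partial>M)\<^sup>2 \<le> (\<integral>\<^sup>+x. (u x)\<^sup>2 \<partial>M)"
  using Cauchy_Schwarz_nn_integral[of u M "\<lambda>_. 1"] by (simp add: emeasure_space_1)

text \<open>Jensen's inequality for the convex function \<open>t \<mapsto> 1 / t\<^sup>2\<close>. If the mean \<open>c\<close> of \<open>u\<close> is positive
  and finite, integrate the tangent inequality \<open>3 / c\<^sup>2 \<le> 1 / t\<^sup>2 + 2 t / c\<^sup>3\<close>, which also holds
  for \<open>t = 0\<close> and \<open>t = \<infinity>\<close>.\<close>

lemma (in prob_space) inverse_square_nn_integral_le:
  fixes u :: "'a \<Rightarrow> ennreal"
  assumes [measurable]: "u \<in> borel_measurable M"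
  shows "(inverse (\<integral>\<^sup>+x. u x \<partial>M))\<^sup>2 \<le> (\<integral>\<^sup>+x. (inverse (u x))\<^sup>2 \<partial>M)"
proof -
  consider "(\<integral>\<^sup>+x. u x \<partial>M) = top" | "(\<integral>\<^sup>+x. u x \<partial>M) = 0"
    | c where "(\<integral>\<^sup>+x. u x \<partial>M) = ennreal c" "0 < c"
    by (cases "\<integral>\<^sup>+x. u x \<partial>M") (metis ennreal_0 less_eq_real_def)+
  then show ?thesis
  proof cases
    case 2
    then have "AE x in M. u x = 0" by (simp add: nn_integral_0_iff_AE)
    then have "(\<integral>\<^sup>+x. (inverse (u x))\<^sup>2 \<partial>M) = (\<integral>\<^sup>+x. top \<partial>M)"
      by (intro nn_integral_cong_AE) (auto elim!: eventually_mono)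
    then show ?thesis by (simp add: emeasure_space_1)
  next
    case 3
    \<comment> \<open>after clearing denominators, the tangent inequality is \<open>(s - c)\<^sup>2 (2 s + c) \<ge> 0\<close>\<close>
    have tangent: "ennreal (3 / c\<^sup>2) \<le> (inverse t)\<^sup>2 + ennreal (2 / c ^ 3) * t" for t
    proof (cases t)
      case (real s)
      show ?thesis
      proof (cases "s = 0")
        case False
        with real have s: "0 < s" by simp
        have "0 \<le> (s - c)\<^sup>2 * (2 * s + c)" using s 3 by simp
        also have "\<dots> = c ^ 3 + 2 * s ^ 3 - 3 * c * s\<^sup>2"
          by (simp add: power2_eq_square power3_eq_cube algebra_simps)
        finally have "0 \<le> (c ^ 3 + 2 * s ^ 3 - 3 * c * s\<^sup>2) / (s\<^sup>2 * c ^ 3)"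
          using s 3 by (intro divide_nonneg_nonneg) auto
        also have "\<dots> = 1 / s\<^sup>2 + 2 / c ^ 3 * s - 3 / c\<^sup>2"
          using s 3 by (simp add: field_simps power2_eq_square power3_eq_cube)
        finally have "3 / c\<^sup>2 \<le> (inverse s)\<^sup>2 + 2 / c ^ 3 * s"
          by (simp add: power_divide inverse_eq_divide)
        then have "ennreal (3 / c\<^sup>2) \<le> ennreal ((inverse s)\<^sup>2 + 2 / c ^ 3 * s)" by (rule ennreal_leI)
        also have "\<dots> = (inverse t)\<^sup>2 + ennreal (2 / c ^ 3) * t"
        proof -
          have "ennreal ((inverse s)\<^sup>2) = (inverse t)\<^sup>2"
            using s real by (simp add: inverse_ennreal ennreal_power)
          moreover have "ennreal (2 / c ^ 3 * s) = ennreal (2 / c ^ 3) * t"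
            using s real 3 by (intro trans[OF ennreal_mult]) auto
          ultimately show ?thesis using s 3 by (subst ennreal_plus) auto
        qed
        finally show ?thesis .
      qed (use real in simp)
    next
      case top
      have "ennreal (2 / c ^ 3) \<noteq> 0" using 3 by simp
      with top show ?thesis by (simp add: ennreal_mult_top)
    qed
    have "ennreal (1 / c\<^sup>2) + ennreal (2 / c\<^sup>2) = ennreal (3 / c\<^sup>2)"
      by (simp add: ennreal_plus[symmetric] add_divide_distrib[symmetric] del: ennreal_plus)
    also have "\<dots> = (\<integral>\<^sup>+x. ennreal (3 / c\<^sup>2) \<partial>M)" by (simp add: emeasure_space_1)
    also have "\<dots> \<le> (\<integral>\<^sup>+x. (inverse (u x))\<^sup>2 + ennreal (2 / c ^ 3) * u x \<partial>M)"
      by (intro nn_integral_mono tangent)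
    also have "\<dots> = (\<integral>\<^sup>+x. (inverse (u x))\<^sup>2 \<partial>M) + ennreal (2 / c ^ 3) * ennreal c"
      by (simp add: nn_integral_add nn_integral_cmult 3)
    also have "ennreal (2 / c ^ 3) * ennreal c = ennreal (2 / c\<^sup>2)"
      using 3 by (simp add: ennreal_mult[symmetric] power2_eq_square power3_eq_cube)
    finally have "ennreal (1 / c\<^sup>2) \<le> (\<integral>\<^sup>+x. (inverse (u x))\<^sup>2 \<partial>M)"
      by (simp add: add.commute[of _ "ennreal (2 / c\<^sup>2)"] ennreal_add_left_cancel_le)
    moreover have "(inverse (\<integral>\<^sup>+x. u x \<partial>M))\<^sup>2 = ennreal (1 / c\<^sup>2)"
      using 3 by (simp add: inverse_ennreal ennreal_power power_divide inverse_eq_divide)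
    ultimately show ?thesis by simp
  qed simp
qed

lemma nn_integral_weighted_swap:
  assumes N: "sigma_finite_measure N" and G: "sigma_finite_measure G"
    and [measurable]: "a \<in> borel_measurable N" "case_prod h \<in> borel_measurable (N \<Otimes>\<^sub>M G)"
  shows "(\<integral>\<^sup>+x. a x * (\<integral>\<^sup>+\<theta>. h x \<theta> \<partial>G) \<partial>N) = (\<integral>\<^sup>+\<theta>. (\<integral>\<^sup>+x. a x * h x \<theta> \<partial>N) \<partial>G)"
proof -
  interpret pair_sigma_finite N G using N G by (simp add: pair_sigma_finite_def)
  have "(\<integral>\<^sup>+x. a x * (\<integral>\<^sup>+\<theta>. h x \<theta> \<partial>G) \<partial>N) = (\<integral>\<^sup>+x. (\<integral>\<^sup>+\<theta>. a x * h x \<theta> \<partial>G) \<partial>N)"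
    by (intro nn_integral_cong nn_integral_cmult[symmetric]) measurable
  also have "\<dots> = (\<integral>\<^sup>+\<theta>. (\<integral>\<^sup>+x. a x * h x \<theta> \<partial>N) \<partial>G)"
    by (rule Fubini'[symmetric]) measurable
  finally show ?thesis .
qed

lemma nn_integral_average_le:
  assumes N: "sigma_finite_measure N" and G: "prob_space G"
    and [measurable]: "a \<in> borel_measurable N" "case_prod h \<in> borel_measurable (N \<Otimes>\<^sub>M G)"
    and le: "\<And>\<theta>. \<theta> \<in> space G \<Longrightarrow> (\<integral>\<^sup>+x. a x * h x \<theta> \<partial>N) \<le> b"
  shows "(\<integral>\<^sup>+x. a x * (\<integral>\<^sup>+\<theta>. h x \<theta> \<partial>G) \<partial>N) \<le> b"
proof -
  interpret prob_space G by fact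
  have "(\<integral>\<^sup>+x. a x * (\<integral>\<^sup>+\<theta>. h x \<theta> \<partial>G) \<partial>N) = (\<integral>\<^sup>+\<theta>. (\<integral>\<^sup>+x. a x * h x \<theta> \<partial>N) \<partial>G)"
    by (rule nn_integral_weighted_swap) (use N in \<open>auto intro: sigma_finite_measure_axioms\<close>)
  also have "\<dots> \<le> (\<integral>\<^sup>+\<theta>. b \<partial>G)" using le by (rule nn_integral_mono)
  finally show ?thesis by (simp add: emeasure_space_1)
qed

lemma prob_density_onD:
  assumes "prob_density_on N f"
  shows "f \<in> borel_measurable N" "\<And>x. x \<in> space N \<Longrightarrow> 0 \<le> f x"
    "(\<integral>\<^sup>+x. ennreal (f x) \<partial>N) = 1"
  using assms by (auto simp: prob_density_on_def)

lemma prob_space_density_of_prob_density_on: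
  assumes "prob_density_on N f"
  shows "prob_space (density N (\<lambda>x. ennreal (f x)))"
proof
  note prob_density_onD(1)[OF assms, measurable]
  show "emeasure (density N (\<lambda>x. ennreal (f x))) (space (density N (\<lambda>x. ennreal (f x)))) = 1"
    using prob_density_onD(3)[OF assms] by (simp add: emeasure_density cong: nn_integral_cong)
qed

text \<open>Division by zero gives \<open>0\<close> for reals and \<open>\<infinity>\<close> for extended reals, so only this direction of
  the comparison holds without \<open>b > 0\<close>.\<close>

lemma ennreal_ratio_le:
  fixes a b :: real
  assumes "0 \<le> a" "0 \<le> b" "ennreal a \<le> a'" "ennreal b = b'"
  shows "ennreal (a / b) \<le> a' / b'"
proof (cases "b = 0")
  case False
  then show ?thesis using assms
    by (simp add: divide_ennreal[symmetric] divide_right_mono_ennreal)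
qed simp

locale mixture_kernel =
  fixes \<nu> :: "'x measure" and \<mu> :: "'t measure" and k :: "'x \<Rightarrow> 't \<Rightarrow> real" and B :: real
  assumes sigma_finite_\<nu>: "sigma_finite_measure \<nu>" and sigma_finite_\<mu>: "sigma_finite_measure \<mu>"
    and k_measurable': "(\<lambda>(x, \<theta>). k x \<theta>) \<in> borel_measurable (\<nu> \<Otimes>\<^sub>M \<mu>)"
    and k_density: "\<And>\<theta>. \<theta> \<in> space \<mu> \<Longrightarrow> prob_density_on \<nu> (\<lambda>x. k x \<theta>)"
    and B_nonneg: "0 \<le> B"
    and ratio_moment: "\<And>\<theta>1 \<theta>2 \<theta>3. \<theta>1 \<in> space \<mu> \<Longrightarrow> \<theta>2 \<in> space \<mu> \<Longrightarrow> \<theta>3 \<in> space \<mu> \<Longrightarrow>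
      (\<integral>\<^sup>+x. (ennreal (k x \<theta>1) / ennreal (k x \<theta>2))\<^sup>2 * ennreal (k x \<theta>3) \<partial>\<nu>) \<le> ennreal B"
begin

sublocale X: sigma_finite_measure \<nu> by (rule sigma_finite_\<nu>)
sublocale T: sigma_finite_measure \<mu> by (rule sigma_finite_\<mu>)

lemma k_measurable[measurable]: "(\<lambda>(x, \<theta>). k x \<theta>) \<in> borel_measurable (\<nu> \<Otimes>\<^sub>M \<mu>)"
  by (rule k_measurable')

lemma k_nonneg: "x \<in> space \<nu> \<Longrightarrow> \<theta> \<in> space \<mu> \<Longrightarrow> 0 \<le> k x \<theta>"
  using prob_density_onD(2)[OF k_density] by auto

text \<open>By convexity, \<open>(\<integral> k dG1)\<^sup>2\<close> and \<open>(\<integral> k dG2)\<^bsup>-2\<^esup>\<close> are at most the averages of \<open>k\<^sup>2\<close> and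
  of \<open>1 / k\<^sup>2\<close>. The integrand is thus dominated by an average, over three parameters, of the integrands
  in \<open>ratio_moment\<close>. The mixing measures are arbitrary rather than given by densities
  because point masses are needed too (\<open>kernel_ratio_moment\<close>).\<close>

lemma mixture_ratio_moment:
  assumes G: "prob_space G1" "prob_space G2" "prob_space G3"
    and sets: "sets G1 = sets \<mu>" "sets G2 = sets \<mu>" "sets G3 = sets \<mu>"
  shows "(\<integral>\<^sup>+x. ((\<integral>\<^sup>+\<theta>. ennreal (k x \<theta>) \<partial>G1) / (\<integral>\<^sup>+\<theta>. ennreal (k x \<theta>) \<partial>G2))\<^sup>2
    * (\<integral>\<^sup>+\<theta>. ennreal (k x \<theta>) \<partial>G3) \<partial>\<nu>) \<le> ennreal B"
proof -
  interpret G1: prob_space G1 by fact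
  interpret G2: prob_space G2 by fact
  interpret G3: prob_space G3 by fact
  have sp: "space G1 = space \<mu>" "space G2 = space \<mu>" "space G3 = space \<mu>"
    by (rule sets_eq_imp_space_eq, rule sets)+
  note [measurable_cong] = sets
  let ?k = "\<lambda>x \<theta>. ennreal (k x \<theta>)"
  let ?I1 = "\<lambda>x. \<integral>\<^sup>+\<theta>. (?k x \<theta>)\<^sup>2 \<partial>G1" and ?I2 = "\<lambda>x. \<integral>\<^sup>+\<theta>. (inverse (?k x \<theta>))\<^sup>2 \<partial>G2"
    and ?I3 = "\<lambda>x. \<integral>\<^sup>+\<theta>. ?k x \<theta> \<partial>G3"
  have "(\<integral>\<^sup>+x. ((\<integral>\<^sup>+\<theta>. ?k x \<theta> \<partial>G1) / (\<integral>\<^sup>+\<theta>. ?k x \<theta> \<partial>G2))\<^sup>2 * ?I3 x \<partial>\<nu>)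
      \<le> (\<integral>\<^sup>+x. (?I1 x * ?I2 x) * ?I3 x \<partial>\<nu>)"
  proof (intro nn_integral_mono mult_right_mono)
    fix x assume x: "x \<in> space \<nu>"
    have [measurable]: "(\<lambda>\<theta>. k x \<theta>) \<in> borel_measurable \<mu>" using x by measurable
    show "((\<integral>\<^sup>+\<theta>. ?k x \<theta> \<partial>G1) / (\<integral>\<^sup>+\<theta>. ?k x \<theta> \<partial>G2))\<^sup>2 \<le> ?I1 x * ?I2 x"
      unfolding divide_ennreal_def power_mult_distrib
      by (intro mult_mono G1.square_nn_integral_le G2.inverse_square_nn_integral_le) auto
  qed simp
  also have "\<dots> \<le> ennreal B"
  proof (rule nn_integral_average_le[OF sigma_finite_\<nu> G(3)])
    fix \<theta>3 assume \<theta>3: "\<theta>3 \<in> space G3"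
    then have [measurable]: "(\<lambda>x. k x \<theta>3) \<in> borel_measurable \<nu>" by (simp add: sp)
    have "(\<integral>\<^sup>+x. (?I1 x * ?k x \<theta>3) * ?I2 x \<partial>\<nu>) \<le> ennreal B"
    proof (rule nn_integral_average_le[OF sigma_finite_\<nu> G(2)])
      fix \<theta>2 assume \<theta>2: "\<theta>2 \<in> space G2"
      then have [measurable]: "(\<lambda>x. k x \<theta>2) \<in> borel_measurable \<nu>" by (simp add: sp)
      have "(\<integral>\<^sup>+x. (?k x \<theta>3 * (inverse (?k x \<theta>2))\<^sup>2) * ?I1 x \<partial>\<nu>) \<le> ennreal B"
      proof (rule nn_integral_average_le[OF sigma_finite_\<nu> G(1)])
        fix \<theta>1 assume \<theta>1: "\<theta>1 \<in> space G1"
        show "(\<integral>\<^sup>+x. ?k x \<theta>3 * (inverse (?k x \<theta>2))\<^sup>2 * (?k x \<theta>1)\<^sup>2 \<partial>\<nu>) \<le> ennreal B"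
          using ratio_moment[of \<theta>1 \<theta>2 \<theta>3] \<theta>1 \<theta>2 \<theta>3
          by (simp add: sp divide_ennreal_def power_mult_distrib mult_ac)
      qed measurable
      then show "(\<integral>\<^sup>+x. ?I1 x * ?k x \<theta>3 * (inverse (?k x \<theta>2))\<^sup>2 \<partial>\<nu>) \<le> ennreal B"
        by (simp add: mult_ac)
    qed measurable
    then show "(\<integral>\<^sup>+x. ?I1 x * ?I2 x * ?k x \<theta>3 \<partial>\<nu>) \<le> ennreal B" by (simp add: mult_ac)
  qed measurable
  finally show ?thesis .
qed

lemma mixture_nonneg:
  assumes "x \<in> space \<nu>" "\<And>\<theta>. \<theta> \<in> space \<mu> \<Longrightarrow> 0 \<le> g \<theta>"
  shows "0 \<le> mixture \<mu> k g x"
  unfolding mixture_def using assms k_nonneg by (intro integral_nonneg_AE AE_I2 mult_nonneg_nonneg) auto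

lemma mixture_measurable[measurable]:
  assumes [measurable]: "g \<in> borel_measurable \<mu>"
  shows "mixture \<mu> k g \<in> borel_measurable \<nu>"
  unfolding mixture_def[abs_def] by measurable

lemma density_measure_nn_integral:
  assumes g: "prob_density_on \<mu> g" and x: "x \<in> space \<nu>"
  shows "(\<integral>\<^sup>+\<theta>. ennreal (k x \<theta>) \<partial>density \<mu> (\<lambda>\<theta>. ennreal (g \<theta>))) = (\<integral>\<^sup>+\<theta>. ennreal (k x \<theta> * g \<theta>) \<partial>\<mu>)"
proof -
  note prob_density_onD(1)[OF g, measurable]
  show ?thesis using x
    by (subst nn_integral_density)
      (auto intro!: nn_integral_cong simp: ennreal_mult k_nonneg prob_density_onD(2)[OF g] mult.commute)
qed

lemma nn_integral_mixture_integral: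
  assumes g: "prob_density_on \<mu> g"
  shows "(\<integral>\<^sup>+x. (\<integral>\<^sup>+\<theta>. ennreal (k x \<theta> * g \<theta>) \<partial>\<mu>) \<partial>\<nu>) = 1"
proof -
  note prob_density_onD(1)[OF g, measurable]
  have "(\<integral>\<^sup>+x. (\<integral>\<^sup>+\<theta>. ennreal (k x \<theta> * g \<theta>) \<partial>\<mu>) \<partial>\<nu>) = (\<integral>\<^sup>+x. 1 * (\<integral>\<^sup>+\<theta>. ennreal (k x \<theta> * g \<theta>) \<partial>\<mu>) \<partial>\<nu>)"
    by simp
  also have "\<dots> = (\<integral>\<^sup>+\<theta>. (\<integral>\<^sup>+x. 1 * ennreal (k x \<theta> * g \<theta>) \<partial>\<nu>) \<partial>\<mu>)"
    by (rule nn_integral_weighted_swap[OF sigma_finite_\<nu> sigma_finite_\<mu>]) measurable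
  also have "\<dots> = (\<integral>\<^sup>+\<theta>. ennreal (g \<theta>) \<partial>\<mu>)"
  proof (rule nn_integral_cong)
    fix \<theta> assume \<theta>: "\<theta> \<in> space \<mu>"
    note prob_density_onD(1)[OF k_density[OF \<theta>], measurable]
    have "(\<integral>\<^sup>+x. 1 * ennreal (k x \<theta> * g \<theta>) \<partial>\<nu>) = (\<integral>\<^sup>+x. ennreal (k x \<theta>) * ennreal (g \<theta>) \<partial>\<nu>)"
      using \<theta> prob_density_onD(2)[OF g] by (intro nn_integral_cong) (simp add: ennreal_mult k_nonneg)
    also have "\<dots> = ennreal (g \<theta>)"
      using prob_density_onD(3)[OF k_density[OF \<theta>]] by (simp add: nn_integral_multc)
    finally show "(\<integral>\<^sup>+x. 1 * ennreal (k x \<theta> * g \<theta>) \<partial>\<nu>) = ennreal (g \<theta>)" .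
  qed
  also have "\<dots> = 1" by (rule prob_density_onD(3)[OF g])
  finally show ?thesis .
qed

lemma mixture_integrable_AE:
  assumes g: "prob_density_on \<mu> g"
  shows "AE x in \<nu>. integrable \<mu> (\<lambda>\<theta>. k x \<theta> * g \<theta>)"
proof -
  note prob_density_onD(1)[OF g, measurable]
  have fin: "AE x in \<nu>. (\<integral>\<^sup>+\<theta>. ennreal (k x \<theta> * g \<theta>) \<partial>\<mu>) \<noteq> \<infinity>"
    by (rule nn_integral_PInf_AE) (simp_all add: nn_integral_mixture_integral[OF g])
  show ?thesis
  proof (use AE_space fin in eventually_elim)
    case (elim x)
    then show ?case
      by (intro integrableI_nonneg)
        (auto intro!: mult_nonneg_nonneg k_nonneg prob_density_onD(2)[OF g] simp: less_top)
  qed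
qed

lemma ennreal_mixture:
  assumes g: "prob_density_on \<mu> g" and "x \<in> space \<nu>" "integrable \<mu> (\<lambda>\<theta>. k x \<theta> * g \<theta>)"
  shows "ennreal (mixture \<mu> k g x) = (\<integral>\<^sup>+\<theta>. ennreal (k x \<theta> * g \<theta>) \<partial>\<mu>)"
  unfolding mixture_def using assms
  by (intro nn_integral_eq_integral[symmetric] AE_I2) (auto intro: mult_nonneg_nonneg k_nonneg prob_density_onD(2)[OF g])

lemma ennreal_mixture_AE:
  assumes g: "prob_density_on \<mu> g"
  shows "AE x in \<nu>. ennreal (mixture \<mu> k g x) = (\<integral>\<^sup>+\<theta>. ennreal (k x \<theta> * g \<theta>) \<partial>\<mu>)"
  using mixture_integrable_AE[OF g] AE_space by eventually_elim (rule ennreal_mixture[OF g])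

text \<open>The Bochner integral of a nonnegative function is either its true integral or the default
  value \<open>0\<close>.\<close>

lemma ennreal_mixture_le:
  assumes g: "prob_density_on \<mu> g" and x: "x \<in> space \<nu>"
  shows "ennreal (mixture \<mu> k g x) \<le> (\<integral>\<^sup>+\<theta>. ennreal (k x \<theta> * g \<theta>) \<partial>\<mu>)"
  using ennreal_mixture[OF g x]
  by (cases "integrable \<mu> (\<lambda>\<theta>. k x \<theta> * g \<theta>)") (auto simp: mixture_def not_integrable_integral_eq)

lemma mixture_density:
  assumes g: "prob_density_on \<mu> g"
  shows "prob_density_on \<nu> (mixture \<mu> k g)"
  unfolding prob_density_on_def
proof (intro conjI ballI)
  note prob_density_onD(1)[OF g, measurable]
  show "mixture \<mu> k g \<in> borel_measurable \<nu>" by measurable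
  show "0 \<le> mixture \<mu> k g x" if "x \<in> space \<nu>" for x
    using that prob_density_onD(2)[OF g] by (rule mixture_nonneg)
  show "(\<integral>\<^sup>+x. ennreal (mixture \<mu> k g x) \<partial>\<nu>) = 1"
    using nn_integral_cong_AE[OF ennreal_mixture_AE[OF g]] nn_integral_mixture_integral[OF g] by simp
qed

lemma density_ratio_moment:
  assumes g: "prob_density_on \<mu> g1" "prob_density_on \<mu> g2" "prob_density_on \<mu> g3"
  shows "(\<integral>\<^sup>+x. ennreal ((mixture \<mu> k g1 x / mixture \<mu> k g2 x)\<^sup>2 * mixture \<mu> k g3 x) \<partial>\<nu>) \<le> ennreal B"
proof -
  let ?G = "\<lambda>g. density \<mu> (\<lambda>\<theta>. ennreal (g \<theta>))"
  have "(\<integral>\<^sup>+x. ennreal ((mixture \<mu> k g1 x / mixture \<mu> k g2 x)\<^sup>2 * mixture \<mu> k g3 x) \<partial>\<nu>)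
    \<le> (\<integral>\<^sup>+x. ((\<integral>\<^sup>+\<theta>. ennreal (k x \<theta>) \<partial>?G g1) / (\<integral>\<^sup>+\<theta>. ennreal (k x \<theta>) \<partial>?G g2))\<^sup>2
        * (\<integral>\<^sup>+\<theta>. ennreal (k x \<theta>) \<partial>?G g3) \<partial>\<nu>)"
  proof (rule nn_integral_mono_AE, use AE_space ennreal_mixture_AE[OF g(2)] in eventually_elim)
    fix x assume x: "x \<in> space \<nu>"
      and e: "ennreal (mixture \<mu> k g2 x) = (\<integral>\<^sup>+\<theta>. ennreal (k x \<theta> * g2 \<theta>) \<partial>\<mu>)"
    note n = mixture_nonneg[OF x prob_density_onD(2)]
    have "ennreal ((mixture \<mu> k g1 x / mixture \<mu> k g2 x)\<^sup>2 * mixture \<mu> k g3 x)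
      = (ennreal (mixture \<mu> k g1 x / mixture \<mu> k g2 x))\<^sup>2 * ennreal (mixture \<mu> k g3 x)"
      using n[OF g(1)] n[OF g(2)] n[OF g(3)] by (simp add: ennreal_mult ennreal_power)
    also have "\<dots> \<le> ((\<integral>\<^sup>+\<theta>. ennreal (k x \<theta> * g1 \<theta>) \<partial>\<mu>) / (\<integral>\<^sup>+\<theta>. ennreal (k x \<theta> * g2 \<theta>) \<partial>\<mu>))\<^sup>2
        * (\<integral>\<^sup>+\<theta>. ennreal (k x \<theta> * g3 \<theta>) \<partial>\<mu>)"
      by (intro mult_mono power_mono_ennreal ennreal_ratio_le n[OF g(1)] n[OF g(2)]
          ennreal_mixture_le g x e) auto
    finally show "ennreal ((mixture \<mu> k g1 x / mixture \<mu> k g2 x)\<^sup>2 * mixture \<mu> k g3 x)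
      \<le> ((\<integral>\<^sup>+\<theta>. ennreal (k x \<theta>) \<partial>?G g1) / (\<integral>\<^sup>+\<theta>. ennreal (k x \<theta>) \<partial>?G g2))\<^sup>2
        * (\<integral>\<^sup>+\<theta>. ennreal (k x \<theta>) \<partial>?G g3)"
      by (simp add: density_measure_nn_integral g x)
  qed
  also have "\<dots> \<le> ennreal B"
    by (rule mixture_ratio_moment) (auto intro: prob_space_density_of_prob_density_on g)
  finally show ?thesis .
qed

lemma kernel_ratio_moment:
  assumes g: "prob_density_on \<mu> g2" "prob_density_on \<mu> g3" and \<theta>: "\<theta> \<in> space \<mu>"
  shows "(\<integral>\<^sup>+x. ennreal ((k x \<theta> / mixture \<mu> k g2 x)\<^sup>2 * mixture \<mu> k g3 x) \<partial>\<nu>) \<le> ennreal B"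
proof -
  let ?G = "\<lambda>g. density \<mu> (\<lambda>\<theta>. ennreal (g \<theta>))"
  have "(\<integral>\<^sup>+x. ennreal ((k x \<theta> / mixture \<mu> k g2 x)\<^sup>2 * mixture \<mu> k g3 x) \<partial>\<nu>)
    \<le> (\<integral>\<^sup>+x. ((\<integral>\<^sup>+\<theta>. ennreal (k x \<theta>) \<partial>return \<mu> \<theta>) / (\<integral>\<^sup>+\<theta>. ennreal (k x \<theta>) \<partial>?G g2))\<^sup>2
        * (\<integral>\<^sup>+\<theta>. ennreal (k x \<theta>) \<partial>?G g3) \<partial>\<nu>)"
  proof (rule nn_integral_mono_AE, use AE_space ennreal_mixture_AE[OF g(1)] in eventually_elim)
    fix x assume x: "x \<in> space \<nu>"
      and e: "ennreal (mixture \<mu> k g2 x) = (\<integral>\<^sup>+\<theta>. ennreal (k x \<theta> * g2 \<theta>) \<partial>\<mu>)"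
    note n = mixture_nonneg[OF x prob_density_onD(2)]
    have [measurable]: "(\<lambda>\<theta>. k x \<theta>) \<in> borel_measurable \<mu>" using x by measurable
    have r: "(\<integral>\<^sup>+\<theta>. ennreal (k x \<theta>) \<partial>return \<mu> \<theta>) = ennreal (k x \<theta>)"
      using \<theta> by (subst nn_integral_return) auto
    have "ennreal ((k x \<theta> / mixture \<mu> k g2 x)\<^sup>2 * mixture \<mu> k g3 x)
      = (ennreal (k x \<theta> / mixture \<mu> k g2 x))\<^sup>2 * ennreal (mixture \<mu> k g3 x)"
      using k_nonneg[OF x \<theta>] n[OF g(1)] n[OF g(2)] by (simp add: ennreal_mult ennreal_power)
    also have "\<dots> \<le> (ennreal (k x \<theta>) / (\<integral>\<^sup>+\<theta>. ennreal (k x \<theta> * g2 \<theta>) \<partial>\<mu>))\<^sup>2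
        * (\<integral>\<^sup>+\<theta>. ennreal (k x \<theta> * g3 \<theta>) \<partial>\<mu>)"
      by (intro mult_mono power_mono_ennreal ennreal_ratio_le n[OF g(1)] k_nonneg[OF x \<theta>]
          ennreal_mixture_le g x e) auto
    finally show "ennreal ((k x \<theta> / mixture \<mu> k g2 x)\<^sup>2 * mixture \<mu> k g3 x)
      \<le> ((\<integral>\<^sup>+\<theta>. ennreal (k x \<theta>) \<partial>return \<mu> \<theta>) / (\<integral>\<^sup>+\<theta>. ennreal (k x \<theta>) \<partial>?G g2))\<^sup>2
        * (\<integral>\<^sup>+\<theta>. ennreal (k x \<theta>) \<partial>?G g3)"
      by (simp add: density_measure_nn_integral g x r)
  qed
  also have "\<dots> \<le> ennreal B"
    by (rule mixture_ratio_moment)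
      (auto intro: prob_space_density_of_prob_density_on g prob_space_return \<theta>)
  finally show ?thesis .
qed

text \<open>Where the first mixture is positive and the second one vanishes, the ratio is infinite; a finite
  ratio moment confines this to a null set.\<close>

lemma mixture_pos_AE:
  assumes g: "prob_density_on \<mu> g1" "prob_density_on \<mu> g2"
  shows "AE x in \<nu>. 0 < mixture \<mu> k g1 x \<longrightarrow> 0 < mixture \<mu> k g2 x"
proof -
  let ?G = "\<lambda>g. density \<mu> (\<lambda>\<theta>. ennreal (g \<theta>))"
  let ?m = "\<lambda>g x. \<integral>\<^sup>+\<theta>. ennreal (k x \<theta>) \<partial>?G g"
  note prob_density_onD(1)[OF g(1), measurable] prob_density_onD(1)[OF g(2), measurable]
  interpret G1: prob_space "?G g1" by (rule prob_space_density_of_prob_density_on[OF g(1)])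
  interpret G2: prob_space "?G g2" by (rule prob_space_density_of_prob_density_on[OF g(2)])
  have "(\<integral>\<^sup>+x. (?m g1 x / ?m g2 x)\<^sup>2 * ?m g1 x \<partial>\<nu>) \<le> ennreal B"
    by (rule mixture_ratio_moment) (auto intro: prob_space_density_of_prob_density_on g)
  then have "(\<integral>\<^sup>+x. (?m g1 x / ?m g2 x)\<^sup>2 * ?m g1 x \<partial>\<nu>) \<noteq> \<infinity>"
    by (auto simp: top_unique)
  then have fin: "AE x in \<nu>. (?m g1 x / ?m g2 x)\<^sup>2 * ?m g1 x \<noteq> \<infinity>"
    by (intro nn_integral_PInf_AE) measurable
  show ?thesis
  proof (use fin AE_space ennreal_mixture_AE[OF g(1)] ennreal_mixture_AE[OF g(2)] in eventually_elim)
    case (elim x)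
    then have e: "?m g1 x = ennreal (mixture \<mu> k g1 x)" "?m g2 x = ennreal (mixture \<mu> k g2 x)"
      by (simp_all add: density_measure_nn_integral g)
    show ?case
    proof
      assume "0 < mixture \<mu> k g1 x"
      with elim(1) have "mixture \<mu> k g2 x \<noteq> 0"
        unfolding e by (auto simp: ennreal_mult_eq_top_iff ennreal_eq_0_iff)
      then show "0 < mixture \<mu> k g2 x"
        using prob_density_onD(2)[OF mixture_density[OF g(2)] elim(2)] by simp
    qed
  qed
qed

section \<open>One step of the recursion\<close>

definition posterior :: "('t \<Rightarrow> real) \<Rightarrow> 'x \<Rightarrow> 't \<Rightarrow> real" where
  "posterior g x \<theta> = k x \<theta> * g \<theta> / mixture \<mu> k g x"

definition pr_step :: "real \<Rightarrow> ('t \<Rightarrow> real) \<Rightarrow> 'x \<Rightarrow> 't \<Rightarrow> real" where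
  "pr_step w g x \<theta> = (1 - w) * g \<theta> + w * posterior g x \<theta>"

lemma posterior_measurable[measurable]:
  assumes [measurable]: "g \<in> borel_measurable \<mu>"
  shows "(\<lambda>(x, \<theta>). posterior g x \<theta>) \<in> borel_measurable (\<nu> \<Otimes>\<^sub>M \<mu>)"
  unfolding posterior_def by measurable

lemma pr_step_measurable[measurable]:
  assumes [measurable]: "g \<in> borel_measurable \<mu>"
  shows "(\<lambda>(x, \<theta>). pr_step w g x \<theta>) \<in> borel_measurable (\<nu> \<Otimes>\<^sub>M \<mu>)"
  unfolding pr_step_def by measurable

text \<open>A Bochner integral that is not zero exists. This makes positivity of the mixture at the
  observation the only condition for an update to be a Bayes update.\<close>

lemma mixture_pos_imp_integrable:
  "0 < mixture \<mu> k g x \<Longrightarrow> integrable \<mu> (\<lambda>\<theta>. k x \<theta> * g \<theta>)"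
  by (cases "integrable \<mu> (\<lambda>\<theta>. k x \<theta> * g \<theta>)") (auto simp: mixture_def not_integrable_integral_eq)

lemma posterior_density:
  assumes g: "prob_density_on \<mu> g" and x: "x \<in> space \<nu>" and pos: "0 < mixture \<mu> k g x"
  shows "prob_density_on \<mu> (posterior g x)"
  unfolding prob_density_on_def
proof (intro conjI ballI)
  note [measurable] = prob_density_onD(1)[OF g]
  have [measurable]: "(\<lambda>\<theta>. k x \<theta>) \<in> borel_measurable \<mu>" using x by measurable
  show "posterior g x \<in> borel_measurable \<mu>" unfolding posterior_def[abs_def] by measurable
  show "0 \<le> posterior g x \<theta>" if "\<theta> \<in> space \<mu>" for \<theta>
    using that x pos by (simp add: posterior_def k_nonneg prob_density_onD(2)[OF g])
  have "(\<integral>\<^sup>+\<theta>. ennreal (posterior g x \<theta>) \<partial>\<mu>)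
    = (\<integral>\<^sup>+\<theta>. ennreal (1 / mixture \<mu> k g x) * ennreal (k x \<theta> * g \<theta>) \<partial>\<mu>)"
    using x pos by (intro nn_integral_cong)
      (simp add: posterior_def k_nonneg prob_density_onD(2)[OF g] ennreal_mult[symmetric])
  also have "\<dots> = ennreal (1 / mixture \<mu> k g x) * ennreal (mixture \<mu> k g x)"
    using ennreal_mixture[OF g x mixture_pos_imp_integrable[OF pos]] by (simp add: nn_integral_cmult)
  also have "\<dots> = 1" using pos by (simp add: ennreal_mult[symmetric])
  finally show "(\<integral>\<^sup>+\<theta>. ennreal (posterior g x \<theta>) \<partial>\<mu>) = 1" .
qed

lemma pr_step_density:
  assumes g: "prob_density_on \<mu> g" and x: "x \<in> space \<nu>" and pos: "0 < mixture \<mu> k g x"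
    and w: "0 \<le> w" "w \<le> 1"
  shows "prob_density_on \<mu> (pr_step w g x)"
  unfolding prob_density_on_def
proof (intro conjI ballI)
  note r = posterior_density[OF g x pos]
  note [measurable] = prob_density_onD(1)[OF g] prob_density_onD(1)[OF r]
  show "pr_step w g x \<in> borel_measurable \<mu>" unfolding pr_step_def[abs_def] by measurable
  show "0 \<le> pr_step w g x \<theta>" if "\<theta> \<in> space \<mu>" for \<theta>
    using that w by (simp add: pr_step_def prob_density_onD(2)[OF r] prob_density_onD(2)[OF g])
  have "(\<integral>\<^sup>+\<theta>. ennreal (pr_step w g x \<theta>) \<partial>\<mu>)
    = (\<integral>\<^sup>+\<theta>. ennreal (1 - w) * ennreal (g \<theta>) + ennreal w * ennreal (posterior g x \<theta>) \<partial>\<mu>)"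
    using w by (intro nn_integral_cong)
      (simp add: pr_step_def prob_density_onD(2)[OF r] prob_density_onD(2)[OF g] ennreal_mult ennreal_plus)
  also have "\<dots> = ennreal (1 - w) + ennreal w"
    by (simp add: nn_integral_add nn_integral_cmult prob_density_onD(3)[OF r] prob_density_onD(3)[OF g])
  also have "\<dots> = 1" using w by (simp flip: ennreal_plus)
  finally show "(\<integral>\<^sup>+\<theta>. ennreal (pr_step w g x \<theta>) \<partial>\<mu>) = 1" .
qed

lemma mixture_pr_step:
  assumes g: "prob_density_on \<mu> g" and x: "x \<in> space \<nu>" and pos: "0 < mixture \<mu> k g x"
  shows "AE y in \<nu>. mixture \<mu> k (pr_step w g x) y
    = (1 - w) * mixture \<mu> k g y + w * mixture \<mu> k (posterior g x) y"
  using mixture_integrable_AE[OF g] mixture_integrable_AE[OF posterior_density[OF g x pos]]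
proof eventually_elim
  case (elim y)
  have "(\<lambda>\<theta>. k y \<theta> * pr_step w g x \<theta>)
    = (\<lambda>\<theta>. (1 - w) * (k y \<theta> * g \<theta>) + w * (k y \<theta> * posterior g x \<theta>))"
    by (simp add: pr_step_def algebra_simps)
  then show ?case using elim by (simp add: mixture_def)
qed

lemma weighted_ratio_moment:
  assumes g: "prob_density_on \<mu> f" "prob_density_on \<mu> g" "prob_density_on \<mu> r"
  shows "(\<integral>\<^sup>+x. ennreal (mixture \<mu> k f x * ((mixture \<mu> k r x / mixture \<mu> k g x)\<^sup>2 + 1)) \<partial>\<nu>)
    \<le> ennreal (B + 1)"
proof -
  note d = mixture_density[OF g(1)] mixture_density[OF g(2)] mixture_density[OF g(3)]
  note [measurable] = prob_density_onD(1)[OF d(1)] prob_density_onD(1)[OF d(2)] prob_density_onD(1)[OF d(3)]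
  have "(\<integral>\<^sup>+x. ennreal (mixture \<mu> k f x * ((mixture \<mu> k r x / mixture \<mu> k g x)\<^sup>2 + 1)) \<partial>\<nu>)
    = (\<integral>\<^sup>+x. ennreal ((mixture \<mu> k r x / mixture \<mu> k g x)\<^sup>2 * mixture \<mu> k f x) + ennreal (mixture \<mu> k f x) \<partial>\<nu>)"
    by (intro nn_integral_cong)
      (simp add: prob_density_onD(2)[OF d(1)] ennreal_plus[symmetric] algebra_simps del: ennreal_plus)
  also have "\<dots> \<le> ennreal B + 1"
    by (simp add: nn_integral_add prob_density_onD(3)[OF d(1)] density_ratio_moment g add_right_mono)
  finally show ?thesis using B_nonneg by simp
qed

lemma weighted_kernel_ratio_moment:
  assumes g: "prob_density_on \<mu> f" "prob_density_on \<mu> g" and \<theta>: "\<theta> \<in> space \<mu>"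
  shows "(\<integral>\<^sup>+x. ennreal (mixture \<mu> k f x * ((k x \<theta> / mixture \<mu> k g x)\<^sup>2 + 1)) \<partial>\<nu>) \<le> ennreal (B + 1)"
proof -
  note d = mixture_density[OF g(1)] mixture_density[OF g(2)] k_density[OF \<theta>]
  note [measurable] = prob_density_onD(1)[OF d(1)] prob_density_onD(1)[OF d(2)] prob_density_onD(1)[OF d(3)]
  have "(\<integral>\<^sup>+x. ennreal (mixture \<mu> k f x * ((k x \<theta> / mixture \<mu> k g x)\<^sup>2 + 1)) \<partial>\<nu>)
    = (\<integral>\<^sup>+x. ennreal ((k x \<theta> / mixture \<mu> k g x)\<^sup>2 * mixture \<mu> k f x) + ennreal (mixture \<mu> k f x) \<partial>\<nu>)"
    by (intro nn_integral_cong)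
      (simp add: prob_density_onD(2)[OF d(1)] ennreal_plus[symmetric] algebra_simps del: ennreal_plus)
  also have "\<dots> \<le> ennreal B + 1"
    by (simp add: nn_integral_add prob_density_onD(3)[OF d(1)] kernel_ratio_moment g \<theta> add_right_mono)
  finally show ?thesis using B_nonneg by simp
qed

text \<open>In contrast to \<open>mixing_kl_step\<close>, the second-order term is bounded here for each single
  observation, since the posterior is a density like any other.\<close>

lemma kl_step:
  assumes f: "prob_density_on \<mu> f" and g: "prob_density_on \<mu> g"
    and x: "x \<in> space \<nu>" and pos: "0 < mixture \<mu> k g x"
    and w: "0 < \<delta>" "0 \<le> w" "w \<le> 1 - \<delta>"
  shows "gen_kl \<nu> (mixture \<mu> k f) (mixture \<mu> k (pr_step w g x))
      + ennreal w * (\<integral>\<^sup>+y. ennreal (mixture \<mu> k f y * mixture \<mu> k (posterior g x) y / mixture \<mu> k g y) \<partial>\<nu>)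
    \<le> gen_kl \<nu> (mixture \<mu> k f) (mixture \<mu> k g) + ennreal w + ennreal (w\<^sup>2 * ((B + 1) / \<delta>))"
proof -
  note r = posterior_density[OF g x pos]
  have s: "prob_density_on \<mu> (pr_step w g x)" by (rule pr_step_density[OF g x pos]) (use w in auto)
  note d = mixture_density[OF f] mixture_density[OF g] mixture_density[OF r] mixture_density[OF s]
  have "gen_kl \<nu> (mixture \<mu> k f) (mixture \<mu> k (pr_step w g x))
      + ennreal w * (\<integral>\<^sup>+y. ennreal (mixture \<mu> k f y * mixture \<mu> k (posterior g x) y / mixture \<mu> k g y) \<partial>\<nu>)
    \<le> gen_kl \<nu> (mixture \<mu> k f) (mixture \<mu> k g) + ennreal w * (\<integral>\<^sup>+y. ennreal (mixture \<mu> k f y) \<partial>\<nu>)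
      + ennreal (w\<^sup>2 / \<delta>) * (\<integral>\<^sup>+y. ennreal (mixture \<mu> k f y *
        ((mixture \<mu> k (posterior g x) y / mixture \<mu> k g y)\<^sup>2 + 1)) \<partial>\<nu>)"
    by (rule gen_kl_mixing_step[OF _ _ _ _ _ _ _ _ w mixture_pr_step[OF g x pos]])
      (auto intro: mixture_pos_AE f g prob_density_onD[OF d(1)] prob_density_onD[OF d(2)]
        prob_density_onD[OF d(3)] prob_density_onD[OF d(4)])
  also have "\<dots> \<le> gen_kl \<nu> (mixture \<mu> k f) (mixture \<mu> k g) + ennreal w * 1
      + ennreal (w\<^sup>2 / \<delta>) * ennreal (B + 1)"
    by (intro add_mono mult_left_mono weighted_ratio_moment f g r)
      (auto simp: prob_density_onD(3)[OF d(1)])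
  also have "ennreal (w\<^sup>2 / \<delta>) * ennreal (B + 1) = ennreal (w\<^sup>2 * ((B + 1) / \<delta>))"
    using w B_nonneg by (subst ennreal_mult[symmetric]) auto
  finally show ?thesis by simp
qed

text \<open>The posterior has the density \<open>k x \<theta> / mixture \<mu> k g x\<close> relative to \<open>g\<close>. The second
  moment of this ratio is kept as an integral over \<open>\<theta>\<close>, as its bound comes from averaging over \<open>x\<close>.\<close>

lemma mixing_kl_step:
  assumes f: "prob_density_on \<mu> f" and g: "prob_density_on \<mu> g" and A[measurable]: "A \<in> sets \<mu>"
    and supp: "AE \<theta> in \<mu>. 0 < f \<theta> * indicator A \<theta> \<longrightarrow> 0 < g \<theta>"
    and x: "x \<in> space \<nu>" and pos: "0 < mixture \<mu> k g x"
    and w: "0 < \<delta>" "0 \<le> w" "w \<le> 1 - \<delta>"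
  shows "gen_kl \<mu> (\<lambda>\<theta>. f \<theta> * indicator A \<theta>) (pr_step w g x)
      + ennreal w * (\<integral>\<^sup>+\<theta>. ennreal (f \<theta> * indicator A \<theta> * (k x \<theta> / mixture \<mu> k g x)) \<partial>\<mu>)
    \<le> gen_kl \<mu> (\<lambda>\<theta>. f \<theta> * indicator A \<theta>) g + ennreal w
      + ennreal (w\<^sup>2 / \<delta>) * (\<integral>\<^sup>+\<theta>. ennreal (f \<theta> * ((k x \<theta> / mixture \<mu> k g x)\<^sup>2 + 1)) \<partial>\<mu>)"
proof -
  note r = posterior_density[OF g x pos]
  have s: "prob_density_on \<mu> (pr_step w g x)" by (rule pr_step_density[OF g x pos]) (use w in auto)
  note [measurable] = prob_density_onD(1)[OF f] prob_density_onD(1)[OF g] prob_density_onD(1)[OF r]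
    prob_density_onD(1)[OF s]
  note f0 = prob_density_onD(2)[OF f]
  let ?\<phi> = "\<lambda>\<theta>. f \<theta> * indicator A \<theta>"
  have ratio: "posterior g x \<theta> / g \<theta> = k x \<theta> / mixture \<mu> k g x" if "0 < g \<theta>" for \<theta>
    using that by (simp add: posterior_def)
  have "gen_kl \<mu> ?\<phi> (pr_step w g x)
      + ennreal w * (\<integral>\<^sup>+\<theta>. ennreal (?\<phi> \<theta> * (k x \<theta> / mixture \<mu> k g x)) \<partial>\<mu>)
    = gen_kl \<mu> ?\<phi> (pr_step w g x) + ennreal w * (\<integral>\<^sup>+\<theta>. ennreal (?\<phi> \<theta> * posterior g x \<theta> / g \<theta>) \<partial>\<mu>)"
  proof (intro arg_cong2[where f = "(+)"] arg_cong2[where f = "(*)"] refl nn_integral_cong_AE)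
    show "AE \<theta> in \<mu>. ennreal (?\<phi> \<theta> * (k x \<theta> / mixture \<mu> k g x)) = ennreal (?\<phi> \<theta> * posterior g x \<theta> / g \<theta>)"
      using supp AE_space
    proof eventually_elim
      case (elim \<theta>)
      then show ?case using f0[of \<theta>] ratio[of \<theta>]
        by (cases "?\<phi> \<theta> = 0") (auto simp: times_divide_eq_right[symmetric] less_le simp del: times_divide_eq_right)
    qed
  qed
  also have "\<dots> \<le> gen_kl \<mu> ?\<phi> g + ennreal w * (\<integral>\<^sup>+\<theta>. ennreal (?\<phi> \<theta>) \<partial>\<mu>)
      + ennreal (w\<^sup>2 / \<delta>) * (\<integral>\<^sup>+\<theta>. ennreal (?\<phi> \<theta> * ((posterior g x \<theta> / g \<theta>)\<^sup>2 + 1)) \<partial>\<mu>)"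
    by (rule gen_kl_mixing_step[OF _ _ _ _ _ _ _ _ w])
      (auto intro: supp prob_density_onD[OF g] prob_density_onD[OF r] simp: f0 pr_step_def)
  also have "\<dots> \<le> gen_kl \<mu> ?\<phi> g + ennreal w * 1
      + ennreal (w\<^sup>2 / \<delta>) * (\<integral>\<^sup>+\<theta>. ennreal (f \<theta> * ((k x \<theta> / mixture \<mu> k g x)\<^sup>2 + 1)) \<partial>\<mu>)"
  proof (intro add_mono mult_left_mono order_refl)
    have "(\<integral>\<^sup>+\<theta>. ennreal (?\<phi> \<theta>) \<partial>\<mu>) \<le> (\<integral>\<^sup>+\<theta>. ennreal (f \<theta>) \<partial>\<mu>)"
      by (intro nn_integral_mono ennreal_leI) (auto simp: f0 indicator_def)
    then show "(\<integral>\<^sup>+\<theta>. ennreal (?\<phi> \<theta>) \<partial>\<mu>) \<le> 1" by (simp add: prob_density_onD(3)[OF f])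
    show "(\<integral>\<^sup>+\<theta>. ennreal (?\<phi> \<theta> * ((posterior g x \<theta> / g \<theta>)\<^sup>2 + 1)) \<partial>\<mu>)
      \<le> (\<integral>\<^sup>+\<theta>. ennreal (f \<theta> * ((k x \<theta> / mixture \<mu> k g x)\<^sup>2 + 1)) \<partial>\<mu>)"
    proof (rule nn_integral_mono_AE, use supp AE_space in eventually_elim)
      case (elim \<theta>)
      then show ?case using f0[of \<theta>] ratio[of \<theta>]
        by (cases "?\<phi> \<theta> = 0") (auto simp: less_le indicator_def split: if_splits)
    qed
  qed simp_all
  finally show ?thesis by simp
qed

text \<open>The expected gain of \<open>kl_step\<close> over an observation \<open>x\<close> drawn from the true
  mixture. With \<open>H \<theta> = \<integral> k y \<theta> * p y / m y \<nu>(dy)\<close>, where \<open>p\<close> and \<open>m\<close> are the mixtures of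
  \<open>f\<close> and \<open>g\<close>, Tonelli's theorem turns the double integral into \<open>\<integral> H\<^sup>2 g\<close>. By the Cauchy--Schwarz
  inequality this is at least \<open>(\<integral> H g)\<^sup>2 = (\<integral> p)\<^sup>2 = 1\<close>.\<close>

lemma cross_moment_ge_1:
  assumes f: "prob_density_on \<mu> f" and g: "prob_density_on \<mu> g"
  shows "1 \<le> (\<integral>\<^sup>+x. ennreal (mixture \<mu> k f x) *
    (\<integral>\<^sup>+y. ennreal (mixture \<mu> k f y * mixture \<mu> k (posterior g x) y / mixture \<mu> k g y) \<partial>\<nu>) \<partial>\<nu>)"
proof -
  let ?p = "mixture \<mu> k f" and ?m = "mixture \<mu> k g"
  let ?G = "density \<mu> (\<lambda>\<theta>. ennreal (g \<theta>))"
  note [measurable] = prob_density_onD(1)[OF f] prob_density_onD(1)[OF g]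
  note p0 = prob_density_onD(2)[OF mixture_density[OF f]]
    and m0 = prob_density_onD(2)[OF mixture_density[OF g]] and g0 = prob_density_onD(2)[OF g]
  interpret G: prob_space ?G by (rule prob_space_density_of_prob_density_on[OF g])
  have sfG: "sigma_finite_measure ?G" by (rule G.sigma_finite_measure_axioms)
  define c where "c x = ennreal (?p x / ?m x)" for x
  define H where "H \<theta> = (\<integral>\<^sup>+x. c x * ennreal (k x \<theta>) \<partial>\<nu>)" for \<theta>
  have [measurable]: "c \<in> borel_measurable \<nu>" unfolding c_def[abs_def] by measurable
  have [measurable]: "H \<in> borel_measurable \<mu>" unfolding H_def[abs_def] by measurable
  have "(\<integral>\<^sup>+\<theta>. H \<theta> \<partial>?G) = (\<integral>\<^sup>+x. c x * (\<integral>\<^sup>+\<theta>. ennreal (k x \<theta>) \<partial>?G) \<partial>\<nu>)"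
    unfolding H_def by (rule nn_integral_weighted_swap[OF sigma_finite_\<nu> sfG, symmetric]) measurable
  also have "\<dots> = (\<integral>\<^sup>+x. ennreal (?p x) \<partial>\<nu>)"
  proof (rule nn_integral_cong_AE, use AE_space mixture_pos_AE[OF f g] ennreal_mixture_AE[OF g] in eventually_elim)
    case (elim x)
    then have e: "(\<integral>\<^sup>+\<theta>. ennreal (k x \<theta>) \<partial>?G) = ennreal (?m x)"
      by (simp add: density_measure_nn_integral[OF g])
    have "0 \<le> ?p x" "0 \<le> ?m x" "?p x \<noteq> 0 \<longrightarrow> ?m x \<noteq> 0"
      using elim(1,2) p0[of x] m0[of x] by auto
    then show ?case unfolding e c_def
      by (cases "?p x = 0") (auto simp: ennreal_mult[symmetric])
  qed
  also have "\<dots> = 1" by (rule prob_density_onD(3)[OF mixture_density[OF f]])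
  finally have "1 \<le> (\<integral>\<^sup>+\<theta>. H \<theta> * H \<theta> \<partial>?G)"
    using G.square_nn_integral_le[of H] by (simp add: power2_eq_square)
  also have "\<dots> = (\<integral>\<^sup>+\<theta>. (\<integral>\<^sup>+x. c x * (ennreal (k x \<theta>) * H \<theta>) \<partial>\<nu>) \<partial>?G)"
    by (intro nn_integral_cong, subst H_def) (auto simp: nn_integral_multc[symmetric] mult.assoc)
  also have "\<dots> = (\<integral>\<^sup>+x. c x * (\<integral>\<^sup>+\<theta>. ennreal (k x \<theta>) * H \<theta> \<partial>?G) \<partial>\<nu>)"
    by (rule nn_integral_weighted_swap[OF sigma_finite_\<nu> sfG, symmetric]) measurable
  also have "\<dots> = (\<integral>\<^sup>+x. ennreal (?p x) *
      (\<integral>\<^sup>+y. ennreal (?p y * mixture \<mu> k (posterior g x) y / ?m y) \<partial>\<nu>) \<partial>\<nu>)"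
  proof (rule nn_integral_cong_AE, use AE_space mixture_pos_AE[OF f g] in eventually_elim)
    case (elim x)
    show ?case
    proof (cases "?p x = 0")
      case False
      with elim p0[of x] have px: "0 < ?p x" and mx: "0 < ?m x" by auto
      note r = posterior_density[OF g elim(1) mx]
      have [measurable]: "(\<lambda>\<theta>. k x \<theta>) \<in> borel_measurable \<mu>" using elim(1) by measurable
      note [measurable] = prob_density_onD(1)[OF r]
      have "c x * (\<integral>\<^sup>+\<theta>. ennreal (k x \<theta>) * H \<theta> \<partial>?G)
          = c x * (\<integral>\<^sup>+\<theta>. ennreal (k x \<theta>) * ennreal (g \<theta>) * H \<theta> \<partial>\<mu>)"
        by (subst nn_integral_density) (auto simp: mult_ac)
      also have "\<dots> = (\<integral>\<^sup>+\<theta>. c x * (ennreal (k x \<theta>) * ennreal (g \<theta>) * H \<theta>) \<partial>\<mu>)"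
        by (simp add: nn_integral_cmult)
      also have "\<dots> = (\<integral>\<^sup>+\<theta>. ennreal (?p x) * (ennreal (posterior g x \<theta>) * H \<theta>) \<partial>\<mu>)"
      proof (rule nn_integral_cong)
        fix \<theta> assume "\<theta> \<in> space \<mu>"
        then have "c x * (ennreal (k x \<theta>) * ennreal (g \<theta>)) = ennreal (?p x) * ennreal (posterior g x \<theta>)"
          using px mx k_nonneg[OF elim(1), of \<theta>] g0[of \<theta>]
          by (simp add: c_def posterior_def ennreal_mult[symmetric])
        then show "c x * (ennreal (k x \<theta>) * ennreal (g \<theta>) * H \<theta>) = ennreal (?p x) * (ennreal (posterior g x \<theta>) * H \<theta>)"
          by (simp only: mult.assoc[symmetric])
      qed
      also have "\<dots> = ennreal (?p x) * (\<integral>\<^sup>+\<theta>. ennreal (posterior g x \<theta>) * H \<theta> \<partial>\<mu>)"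
        by (simp add: nn_integral_cmult)
      also have "(\<integral>\<^sup>+\<theta>. ennreal (posterior g x \<theta>) * H \<theta> \<partial>\<mu>)
        = (\<integral>\<^sup>+\<theta>. (\<integral>\<^sup>+y. c y * (ennreal (k y \<theta>) * ennreal (posterior g x \<theta>)) \<partial>\<nu>) \<partial>\<mu>)"
        by (intro nn_integral_cong, subst H_def) (auto simp: nn_integral_cmult[symmetric] mult_ac)
      also have "\<dots> = (\<integral>\<^sup>+y. c y * (\<integral>\<^sup>+\<theta>. ennreal (k y \<theta>) * ennreal (posterior g x \<theta>) \<partial>\<mu>) \<partial>\<nu>)"
        by (rule nn_integral_weighted_swap[OF sigma_finite_\<nu> sigma_finite_\<mu>, symmetric]) measurable
      also have "\<dots> = (\<integral>\<^sup>+y. ennreal (?p y * mixture \<mu> k (posterior g x) y / ?m y) \<partial>\<nu>)"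
      proof (rule nn_integral_cong_AE, use AE_space ennreal_mixture_AE[OF r] in eventually_elim)
        case y: (elim y)
        have "(\<integral>\<^sup>+\<theta>. ennreal (k y \<theta>) * ennreal (posterior g x \<theta>) \<partial>\<mu>) = ennreal (mixture \<mu> k (posterior g x) y)"
          unfolding y(2) using y(1)
          by (intro nn_integral_cong) (simp add: ennreal_mult k_nonneg prob_density_onD(2)[OF r])
        then show ?case
          using y(1) p0[of y] m0[of y] prob_density_onD(2)[OF mixture_density[OF r], of y]
          by (simp add: c_def ennreal_mult[symmetric])
      qed
      finally show ?thesis .
    qed (simp add: c_def)
  qed
  finally show ?thesis .
qed

lemma mixture_pr_step_measurable[measurable]:
  assumes [measurable]: "g \<in> borel_measurable \<mu>"
  shows "(\<lambda>(x, y). mixture \<mu> k (pr_step w g x) y) \<in> borel_measurable (\<nu> \<Otimes>\<^sub>M \<nu>)"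
    "(\<lambda>(x, y). mixture \<mu> k (posterior g x) y) \<in> borel_measurable (\<nu> \<Otimes>\<^sub>M \<nu>)"
  unfolding mixture_def by measurable

lemma nn_integral_mixture_density:
  assumes f: "prob_density_on \<mu> f" and [measurable]: "u \<in> borel_measurable \<nu>"
  shows "(\<integral>\<^sup>+x. u x \<partial>density \<nu> (\<lambda>x. ennreal (mixture \<mu> k f x)))
    = (\<integral>\<^sup>+x. ennreal (mixture \<mu> k f x) * u x \<partial>\<nu>)"
proof -
  note [measurable] = prob_density_onD(1)[OF f]
  show ?thesis by (rule nn_integral_density) measurable
qed

lemma kl_step_expectation:
  assumes f: "prob_density_on \<mu> f" and g: "prob_density_on \<mu> g"
    and w: "0 < \<delta>" "0 \<le> w" "w \<le> 1 - \<delta>"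
  shows "(\<integral>\<^sup>+x. gen_kl \<nu> (mixture \<mu> k f) (mixture \<mu> k (pr_step w g x)) \<partial>density \<nu> (\<lambda>x. ennreal (mixture \<mu> k f x)))
    \<le> gen_kl \<nu> (mixture \<mu> k f) (mixture \<mu> k g) + ennreal (w\<^sup>2 * ((B + 1) / \<delta>))"
proof -
  let ?P = "density \<nu> (\<lambda>x. ennreal (mixture \<mu> k f x))"
  note d = mixture_density[OF f]
  note [measurable] = prob_density_onD(1)[OF f] prob_density_onD(1)[OF g] prob_density_onD(1)[OF d]
  interpret P: prob_space ?P by (rule prob_space_density_of_prob_density_on[OF d])
  let ?K = "\<lambda>x. gen_kl \<nu> (mixture \<mu> k f) (mixture \<mu> k (pr_step w g x))"
  let ?J = "\<lambda>x. \<integral>\<^sup>+y. ennreal (mixture \<mu> k f y * mixture \<mu> k (posterior g x) y / mixture \<mu> k g y) \<partial>\<nu>"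
  have [measurable]: "?K \<in> borel_measurable \<nu>" unfolding gen_kl_def by measurable
  have [measurable]: "?J \<in> borel_measurable \<nu>" by measurable
  have J: "1 \<le> (\<integral>\<^sup>+x. ?J x \<partial>?P)"
    using cross_moment_ge_1[OF f g] by (simp add: nn_integral_mixture_density[OF f])
  have "ennreal w + (\<integral>\<^sup>+x. ?K x \<partial>?P) = ennreal w * 1 + (\<integral>\<^sup>+x. ?K x \<partial>?P)" by simp
  also have "\<dots> \<le> ennreal w * (\<integral>\<^sup>+x. ?J x \<partial>?P) + (\<integral>\<^sup>+x. ?K x \<partial>?P)"
    by (intro add_right_mono mult_left_mono J) simp
  also have "\<dots> = (\<integral>\<^sup>+x. ?K x + ennreal w * ?J x \<partial>?P)"
    by (simp add: nn_integral_add nn_integral_cmult add.commute)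
  also have "\<dots> \<le> (\<integral>\<^sup>+x. gen_kl \<nu> (mixture \<mu> k f) (mixture \<mu> k g) + ennreal w
      + ennreal (w\<^sup>2 * ((B + 1) / \<delta>)) \<partial>?P)"
  proof (rule nn_integral_mono_AE)
    have "AE x in \<nu>. 0 < ennreal (mixture \<mu> k f x) \<longrightarrow> ?K x + ennreal w * ?J x
      \<le> gen_kl \<nu> (mixture \<mu> k f) (mixture \<mu> k g) + ennreal w + ennreal (w\<^sup>2 * ((B + 1) / \<delta>))"
      using AE_space mixture_pos_AE[OF f g]
      by eventually_elim (use kl_step[OF f g _ _ w] in simp)
    then show "AE x in ?P. ?K x + ennreal w * ?J x
      \<le> gen_kl \<nu> (mixture \<mu> k f) (mixture \<mu> k g) + ennreal w + ennreal (w\<^sup>2 * ((B + 1) / \<delta>))"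
      by (subst AE_density) auto
  qed
  also have "\<dots> = ennreal w + (gen_kl \<nu> (mixture \<mu> k f) (mixture \<mu> k g) + ennreal (w\<^sup>2 * ((B + 1) / \<delta>)))"
    using P.emeasure_space_1 by (simp add: add_ac)
  finally show ?thesis by (simp add: ennreal_add_left_cancel_le)
qed

text \<open>The integral of \<open>p\<^sup>2 / m\<close> is an average with respect to \<open>f\<close>, once one factor \<open>p\<close> is
  expanded as a mixture. In this form the contribution of a set of parameters can be split off.\<close>

lemma kl_le_linear_functional:
  assumes f: "prob_density_on \<mu> f" and g: "prob_density_on \<mu> g"
  shows "gen_kl \<nu> (mixture \<mu> k f) (mixture \<mu> k g) + 1
    \<le> (\<integral>\<^sup>+\<theta>. ennreal (f \<theta>) * (\<integral>\<^sup>+x. ennreal (mixture \<mu> k f x) * ennreal (k x \<theta> / mixture \<mu> k g x) \<partial>\<nu>) \<partial>\<mu>)"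
proof -
  let ?p = "mixture \<mu> k f" and ?m = "mixture \<mu> k g"
  note d = mixture_density[OF f] mixture_density[OF g]
  note [measurable] = prob_density_onD(1)[OF f] prob_density_onD(1)[OF g] prob_density_onD(1)[OF d(1)]
    prob_density_onD(1)[OF d(2)]
  note p0 = prob_density_onD(2)[OF d(1)] and m0 = prob_density_onD(2)[OF d(2)]
    and f0 = prob_density_onD(2)[OF f]
  have "gen_kl \<nu> ?p ?m + 1 \<le> (\<integral>\<^sup>+x. ennreal ((?p x)\<^sup>2 / ?m x) \<partial>\<nu>)"
    by (rule gen_kl_le_chi_square)
      (auto intro: mixture_pos_AE f g prob_density_onD[OF d(1)] prob_density_onD[OF d(2)])
  also have "\<dots> = (\<integral>\<^sup>+x. ennreal (?p x / ?m x) * (\<integral>\<^sup>+\<theta>. ennreal (k x \<theta> * f \<theta>) \<partial>\<mu>) \<partial>\<nu>)"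
  proof (rule nn_integral_cong_AE, use AE_space ennreal_mixture_AE[OF f] in eventually_elim)
    case (elim x)
    show ?case unfolding elim(2)[symmetric] using p0[OF elim(1)] m0[OF elim(1)]
      by (simp add: ennreal_mult[symmetric] power2_eq_square)
  qed
  also have "\<dots> = (\<integral>\<^sup>+\<theta>. (\<integral>\<^sup>+x. ennreal (?p x / ?m x) * ennreal (k x \<theta> * f \<theta>) \<partial>\<nu>) \<partial>\<mu>)"
    by (rule nn_integral_weighted_swap[OF sigma_finite_\<nu> sigma_finite_\<mu>]) measurable
  also have "\<dots> = (\<integral>\<^sup>+\<theta>. ennreal (f \<theta>) * (\<integral>\<^sup>+x. ennreal (?p x) * ennreal (k x \<theta> / ?m x) \<partial>\<nu>) \<partial>\<mu>)"
  proof (rule nn_integral_cong)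
    fix \<theta> assume \<theta>: "\<theta> \<in> space \<mu>"
    note [measurable] = prob_density_onD(1)[OF k_density[OF \<theta>]]
    have "(\<integral>\<^sup>+x. ennreal (?p x / ?m x) * ennreal (k x \<theta> * f \<theta>) \<partial>\<nu>)
      = (\<integral>\<^sup>+x. ennreal (f \<theta>) * (ennreal (?p x) * ennreal (k x \<theta> / ?m x)) \<partial>\<nu>)"
      using f0[OF \<theta>] by (intro nn_integral_cong)
        (simp add: ennreal_mult[symmetric] p0 m0 k_nonneg[OF _ \<theta>] mult_ac)
    then show "(\<integral>\<^sup>+x. ennreal (?p x / ?m x) * ennreal (k x \<theta> * f \<theta>) \<partial>\<nu>)
      = ennreal (f \<theta>) * (\<integral>\<^sup>+x. ennreal (?p x) * ennreal (k x \<theta> / ?m x) \<partial>\<nu>)"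
      by (simp add: nn_integral_cmult)
  qed
  finally show ?thesis .
qed

text \<open>By Tonelli's theorem the expected gain of \<open>mixing_kl_step\<close> is \<open>\<integral> f H\<close> over \<open>A\<close>,
  where \<open>H \<theta>\<close> is the mean of \<open>k x \<theta> / mixture \<mu> k g x\<close> over \<open>x\<close>. The integral of \<open>f H\<close> over the
  whole space is at least \<open>1\<close> plus the divergence of the mixtures, and \<open>H \<le> B + 1\<close> bounds the part
  lost outside \<open>A\<close>.\<close>

lemma mixing_kl_step_expectation:
  assumes f: "prob_density_on \<mu> f" and g: "prob_density_on \<mu> g" and A[measurable]: "A \<in> sets \<mu>"
    and supp: "AE \<theta> in \<mu>. 0 < f \<theta> * indicator A \<theta> \<longrightarrow> 0 < g \<theta>"
    and w: "0 < \<delta>" "0 \<le> w" "w \<le> 1 - \<delta>"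
  shows "(\<integral>\<^sup>+x. gen_kl \<mu> (\<lambda>\<theta>. f \<theta> * indicator A \<theta>) (pr_step w g x) \<partial>density \<nu> (\<lambda>x. ennreal (mixture \<mu> k f x)))
      + ennreal w * gen_kl \<nu> (mixture \<mu> k f) (mixture \<mu> k g)
    \<le> gen_kl \<mu> (\<lambda>\<theta>. f \<theta> * indicator A \<theta>) g
      + ennreal w * (ennreal (B + 1) * (\<integral>\<^sup>+\<theta>. ennreal (f \<theta>) * indicator (space \<mu> - A) \<theta> \<partial>\<mu>))
      + ennreal (w\<^sup>2 * ((B + 1) / \<delta>))"
proof -
  let ?p = "mixture \<mu> k f" and ?m = "mixture \<mu> k g" and ?\<phi> = "\<lambda>\<theta>. f \<theta> * indicator A \<theta>"
  let ?P = "density \<nu> (\<lambda>x. ennreal (?p x))"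
  note d = mixture_density[OF f] mixture_density[OF g]
  note [measurable] = prob_density_onD(1)[OF f] prob_density_onD(1)[OF g] prob_density_onD(1)[OF d(1)]
    prob_density_onD(1)[OF d(2)]
  note p0 = prob_density_onD(2)[OF d(1)] and m0 = prob_density_onD(2)[OF d(2)]
    and f0 = prob_density_onD(2)[OF f]
  interpret P: prob_space ?P by (rule prob_space_density_of_prob_density_on[OF d(1)])
  let ?D = "\<lambda>x. gen_kl \<mu> ?\<phi> (pr_step w g x)"
  let ?L = "\<lambda>x. \<integral>\<^sup>+\<theta>. ennreal (?\<phi> \<theta> * (k x \<theta> / ?m x)) \<partial>\<mu>"
  let ?Q = "\<lambda>x. \<integral>\<^sup>+\<theta>. ennreal (f \<theta> * ((k x \<theta> / ?m x)\<^sup>2 + 1)) \<partial>\<mu>"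
  let ?H = "\<lambda>\<theta>. \<integral>\<^sup>+x. ennreal (?p x) * ennreal (k x \<theta> / ?m x) \<partial>\<nu>"
  define \<eta> where "\<eta> = (\<integral>\<^sup>+\<theta>. ennreal (f \<theta>) * indicator (space \<mu> - A) \<theta> \<partial>\<mu>)"
  have [measurable]: "?D \<in> borel_measurable \<nu>" unfolding gen_kl_def by measurable
  have [measurable]: "?L \<in> borel_measurable \<nu>" "?Q \<in> borel_measurable \<nu>" by measurable
  have H_le: "?H \<theta> \<le> ennreal (B + 1)" if \<theta>: "\<theta> \<in> space \<mu>" for \<theta>
  proof -
    have "?H \<theta> \<le> (\<integral>\<^sup>+x. ennreal (?p x * ((k x \<theta> / ?m x)\<^sup>2 + 1)) \<partial>\<nu>)"
    proof (intro nn_integral_mono)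
      fix x assume x: "x \<in> space \<nu>"
      define t where "t = k x \<theta> / ?m x"
      have "0 \<le> t" using k_nonneg[OF x \<theta>] m0[OF x] by (simp add: t_def)
      have "?p x * t \<le> ?p x * (t\<^sup>2 + 1)"
        using le_square_plus_1 p0[OF x] by (rule mult_left_mono)
      then show "ennreal (?p x) * ennreal (k x \<theta> / ?m x) \<le> ennreal (?p x * ((k x \<theta> / ?m x)\<^sup>2 + 1))"
        unfolding t_def[symmetric] using p0[OF x] \<open>0 \<le> t\<close>
        by (subst ennreal_mult[symmetric]) (auto intro!: ennreal_leI)
    qed
    also have "\<dots> \<le> ennreal (B + 1)" by (rule weighted_kernel_ratio_moment[OF f g \<theta>])
    finally show ?thesis .
  qed
  have L: "(\<integral>\<^sup>+x. ?L x \<partial>?P) = (\<integral>\<^sup>+\<theta>. ennreal (?\<phi> \<theta>) * ?H \<theta> \<partial>\<mu>)"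
  proof -
    have "(\<integral>\<^sup>+x. ?L x \<partial>?P) = (\<integral>\<^sup>+x. ennreal (?p x) * ?L x \<partial>\<nu>)"
      by (rule nn_integral_mixture_density[OF f]) measurable
    also have "\<dots> = (\<integral>\<^sup>+\<theta>. (\<integral>\<^sup>+x. ennreal (?p x) * ennreal (?\<phi> \<theta> * (k x \<theta> / ?m x)) \<partial>\<nu>) \<partial>\<mu>)"
      by (rule nn_integral_weighted_swap[OF sigma_finite_\<nu> sigma_finite_\<mu>]) measurable
    also have "\<dots> = (\<integral>\<^sup>+\<theta>. ennreal (?\<phi> \<theta>) * ?H \<theta> \<partial>\<mu>)"
    proof (rule nn_integral_cong)
      fix \<theta> assume \<theta>: "\<theta> \<in> space \<mu>"
      note [measurable] = prob_density_onD(1)[OF k_density[OF \<theta>]]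
      have "(\<integral>\<^sup>+x. ennreal (?p x) * ennreal (?\<phi> \<theta> * (k x \<theta> / ?m x)) \<partial>\<nu>)
        = (\<integral>\<^sup>+x. ennreal (?\<phi> \<theta>) * (ennreal (?p x) * ennreal (k x \<theta> / ?m x)) \<partial>\<nu>)"
        using f0[OF \<theta>] by (intro nn_integral_cong)
          (simp add: ennreal_mult[symmetric] p0 m0 k_nonneg[OF _ \<theta>] mult_ac)
      then show "(\<integral>\<^sup>+x. ennreal (?p x) * ennreal (?\<phi> \<theta> * (k x \<theta> / ?m x)) \<partial>\<nu>) = ennreal (?\<phi> \<theta>) * ?H \<theta>"
        by (simp add: nn_integral_cmult)
    qed
    finally show ?thesis .
  qed
  have Q: "(\<integral>\<^sup>+x. ?Q x \<partial>?P) \<le> ennreal (B + 1)"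
  proof -
    have "(\<integral>\<^sup>+x. ?Q x \<partial>?P) = (\<integral>\<^sup>+x. ennreal (?p x) * ?Q x \<partial>\<nu>)"
      by (rule nn_integral_mixture_density[OF f]) measurable
    also have "\<dots> = (\<integral>\<^sup>+\<theta>. (\<integral>\<^sup>+x. ennreal (?p x) * ennreal (f \<theta> * ((k x \<theta> / ?m x)\<^sup>2 + 1)) \<partial>\<nu>) \<partial>\<mu>)"
      by (rule nn_integral_weighted_swap[OF sigma_finite_\<nu> sigma_finite_\<mu>]) measurable
    also have "\<dots> \<le> (\<integral>\<^sup>+\<theta>. ennreal (f \<theta>) * ennreal (B + 1) \<partial>\<mu>)"
    proof (rule nn_integral_mono)
      fix \<theta> assume \<theta>: "\<theta> \<in> space \<mu>"
      note [measurable] = prob_density_onD(1)[OF k_density[OF \<theta>]]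
      have "(\<integral>\<^sup>+x. ennreal (?p x) * ennreal (f \<theta> * ((k x \<theta> / ?m x)\<^sup>2 + 1)) \<partial>\<nu>)
        = (\<integral>\<^sup>+x. ennreal (f \<theta>) * ennreal (?p x * ((k x \<theta> / ?m x)\<^sup>2 + 1)) \<partial>\<nu>)"
        using f0[OF \<theta>] by (intro nn_integral_cong) (subst (1 2) ennreal_mult[symmetric]; simp add: p0 mult_ac)
      also have "\<dots> = ennreal (f \<theta>) * (\<integral>\<^sup>+x. ennreal (?p x * ((k x \<theta> / ?m x)\<^sup>2 + 1)) \<partial>\<nu>)"
        by (rule nn_integral_cmult) measurable
      also have "\<dots> \<le> ennreal (f \<theta>) * ennreal (B + 1)"
        by (intro mult_left_mono weighted_kernel_ratio_moment f g \<theta>) simp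
      finally show "(\<integral>\<^sup>+x. ennreal (?p x) * ennreal (f \<theta> * ((k x \<theta> / ?m x)\<^sup>2 + 1)) \<partial>\<nu>)
        \<le> ennreal (f \<theta>) * ennreal (B + 1)" .
    qed
    also have "\<dots> = ennreal (B + 1)"
      by (subst nn_integral_multc) (simp_all add: prob_density_onD(3)[OF f])
    finally show ?thesis .
  qed
  have KL: "gen_kl \<nu> ?p ?m + 1 \<le> (\<integral>\<^sup>+x. ?L x \<partial>?P) + ennreal (B + 1) * \<eta>"
  proof -
    have "gen_kl \<nu> ?p ?m + 1 \<le> (\<integral>\<^sup>+\<theta>. ennreal (f \<theta>) * ?H \<theta> \<partial>\<mu>)" by (rule kl_le_linear_functional[OF f g])
    also have "\<dots> \<le> (\<integral>\<^sup>+\<theta>. ennreal (?\<phi> \<theta>) * ?H \<theta> + ennreal (B + 1) * (ennreal (f \<theta>) * indicator (space \<mu> - A) \<theta>) \<partial>\<mu>)"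
    proof (rule nn_integral_mono)
      fix \<theta> assume \<theta>: "\<theta> \<in> space \<mu>"
      show "ennreal (f \<theta>) * ?H \<theta> \<le> ennreal (?\<phi> \<theta>) * ?H \<theta> + ennreal (B + 1) * (ennreal (f \<theta>) * indicator (space \<mu> - A) \<theta>)"
        using \<theta> mult_left_mono[OF H_le[OF \<theta>], of "ennreal (f \<theta>)"]
        by (cases "\<theta> \<in> A") (simp_all add: mult.commute)
    qed
    also have "\<dots> = (\<integral>\<^sup>+x. ?L x \<partial>?P) + ennreal (B + 1) * \<eta>"
      unfolding L \<eta>_def by (subst nn_integral_add) (auto simp: nn_integral_cmult)
    finally show ?thesis .
  qed
  have "(\<integral>\<^sup>+x. ?D x + ennreal w * ?L x \<partial>?P)
    \<le> (\<integral>\<^sup>+x. gen_kl \<mu> ?\<phi> g + ennreal w + ennreal (w\<^sup>2 / \<delta>) * ?Q x \<partial>?P)"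
  proof (rule nn_integral_mono_AE)
    have "AE x in \<nu>. 0 < ennreal (?p x) \<longrightarrow>
      ?D x + ennreal w * ?L x \<le> gen_kl \<mu> ?\<phi> g + ennreal w + ennreal (w\<^sup>2 / \<delta>) * ?Q x"
      using AE_space mixture_pos_AE[OF f g]
      by eventually_elim (use mixing_kl_step[OF f g A supp _ _ w] in simp)
    then show "AE x in ?P. ?D x + ennreal w * ?L x \<le> gen_kl \<mu> ?\<phi> g + ennreal w + ennreal (w\<^sup>2 / \<delta>) * ?Q x"
      by (subst AE_density) auto
  qed
  then have main: "(\<integral>\<^sup>+x. ?D x \<partial>?P) + ennreal w * (\<integral>\<^sup>+x. ?L x \<partial>?P)
      \<le> gen_kl \<mu> ?\<phi> g + ennreal w + ennreal (w\<^sup>2 / \<delta>) * (\<integral>\<^sup>+x. ?Q x \<partial>?P)"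
    using P.emeasure_space_1 by (simp add: nn_integral_add nn_integral_cmult)
  have "ennreal w + ((\<integral>\<^sup>+x. ?D x \<partial>?P) + ennreal w * gen_kl \<nu> ?p ?m)
    = (\<integral>\<^sup>+x. ?D x \<partial>?P) + ennreal w * (gen_kl \<nu> ?p ?m + 1)" by (simp add: distrib_left add_ac)
  also have "\<dots> \<le> (\<integral>\<^sup>+x. ?D x \<partial>?P) + ennreal w * ((\<integral>\<^sup>+x. ?L x \<partial>?P) + ennreal (B + 1) * \<eta>)"
    by (intro add_left_mono mult_left_mono KL) simp
  also have "\<dots> = ((\<integral>\<^sup>+x. ?D x \<partial>?P) + ennreal w * (\<integral>\<^sup>+x. ?L x \<partial>?P)) + ennreal w * (ennreal (B + 1) * \<eta>)"
    by (simp only: distrib_left add_ac)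
  also have "\<dots> \<le> (gen_kl \<mu> ?\<phi> g + ennreal w + ennreal (w\<^sup>2 / \<delta>) * ennreal (B + 1)) + ennreal w * (ennreal (B + 1) * \<eta>)"
    by (intro add_right_mono order_trans[OF main] add_left_mono mult_left_mono Q) simp
  also have "ennreal (w\<^sup>2 / \<delta>) * ennreal (B + 1) = ennreal (w\<^sup>2 * ((B + 1) / \<delta>))"
    using w B_nonneg by (subst ennreal_mult[symmetric]) auto
  also have "gen_kl \<mu> ?\<phi> g + ennreal w + ennreal (w\<^sup>2 * ((B + 1) / \<delta>)) + ennreal w * (ennreal (B + 1) * \<eta>)
    = ennreal w + (gen_kl \<mu> ?\<phi> g + ennreal w * (ennreal (B + 1) * \<eta>) + ennreal (w\<^sup>2 * ((B + 1) / \<delta>)))"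
    by (simp only: add_ac)
  finally show ?thesis unfolding \<eta>_def[symmetric] by (simp only: ennreal_add_left_cancel_le) simp
qed

end

section \<open>The recursion along a random sample\<close>

lemma recursive_estimate_cong:
  "(\<And>i. i \<in> {1..n} \<Longrightarrow> xs i = ys i) \<Longrightarrow>
    recursive_estimate \<mu> k w f0 xs n = recursive_estimate \<mu> k w f0 ys n"
proof (induction n)
  case (Suc n)
  then have IH: "recursive_estimate \<mu> k w f0 xs n = recursive_estimate \<mu> k w f0 ys n" by simp
  show ?case using Suc.prems[of "Suc n"] by (simp add: IH)
qed simp

locale predictive_recursion = mixture_kernel \<nu> \<mu> k B + M: prob_space M
  for \<nu> :: "'x measure" and \<mu> :: "'t measure" and k :: "'x \<Rightarrow> 't \<Rightarrow> real" and B :: real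
    and M :: "'a measure" +
  fixes f f0 :: "'t \<Rightarrow> real" and w :: "nat \<Rightarrow> real" and X :: "nat \<Rightarrow> 'a \<Rightarrow> 'x" and \<delta> :: real
  assumes f_density: "prob_density_on \<mu> f" and f0_density: "prob_density_on \<mu> f0"
    and f0_support: "AE \<theta> in \<mu>. 0 < f \<theta> \<longrightarrow> 0 < f0 \<theta>"
    and X_indep: "M.indep_vars (\<lambda>_. \<nu>) X {1..}"
    and X_distr: "\<And>i. i \<ge> 1 \<Longrightarrow> distr M \<nu> (X i) = density \<nu> (\<lambda>x. ennreal (mixture \<mu> k f x))"
    and \<delta>_pos: "0 < \<delta>" and w_bounds: "\<And>i. i \<ge> 1 \<Longrightarrow> 0 \<le> w i" "\<And>i. i \<ge> 1 \<Longrightarrow> w i \<le> 1 - \<delta>"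
begin

abbreviation est :: "nat \<Rightarrow> (nat \<Rightarrow> 'x) \<Rightarrow> 't \<Rightarrow> real" where
  "est n xs \<equiv> recursive_estimate \<mu> k w f0 xs n"

abbreviation P :: "'x measure" where "P \<equiv> density \<nu> (\<lambda>x. ennreal (mixture \<mu> k f x))"

text \<open>Truncating the sample to a finite product space makes the estimate after \<open>n\<close> steps a measurable
  function of the first \<open>n\<close> observations, which are independent of the next one.\<close>

definition hist :: "nat \<Rightarrow> 'a \<Rightarrow> nat \<Rightarrow> 'x" where
  "hist n \<omega> = restrict (\<lambda>i. X i \<omega>) {1..n}"

abbreviation hist_space :: "nat \<Rightarrow> (nat \<Rightarrow> 'x) measure" where
  "hist_space n \<equiv> Pi\<^sub>M {1..n} (\<lambda>_. \<nu>)"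

lemma X_measurable[measurable]: "i \<ge> 1 \<Longrightarrow> X i \<in> measurable M \<nu>"
  using M.indep_vars_def[of "\<lambda>_. \<nu>" X "{1..}"] X_indep by auto

lemma hist_measurable[measurable]: "hist n \<in> measurable M (hist_space n)"
  unfolding hist_def[abs_def] by measurable

lemma est_hist: "est n (hist n \<omega>) = est n (\<lambda>i. X i \<omega>)"
  by (rule recursive_estimate_cong) (simp add: hist_def)

lemma est_Suc: "est (Suc n) xs = pr_step (w (Suc n)) (est n xs) (xs (Suc n))"
  by (rule ext) (simp add: pr_step_def posterior_def)

declare recursive_estimate.simps(2) [simp del]

lemma est_fun_upd: "est (Suc n) (h(Suc n := x)) = pr_step (w (Suc n)) (est n h) x"
proof -
  have "est n (h(Suc n := x)) = est n h" by (rule recursive_estimate_cong) auto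
  then show ?thesis by (simp only: est_Suc fun_upd_same)
qed

lemma est_measurable:
  "{1..n} \<subseteq> I \<Longrightarrow> (\<lambda>(h, \<theta>). est n h \<theta>) \<in> borel_measurable (Pi\<^sub>M I (\<lambda>_. \<nu>) \<Otimes>\<^sub>M \<mu>)"
proof (induction n)
  case 0
  note [measurable] = prob_density_onD(1)[OF f0_density]
  show ?case by simp
next
  case (Suc n)
  have "{1..n} \<subseteq> I" using Suc.prems by auto
  note Suc.IH[OF this, measurable]
  have [measurable]: "(\<lambda>h. h (Suc n)) \<in> measurable (Pi\<^sub>M I (\<lambda>_. \<nu>)) \<nu>"
    using Suc.prems by (intro measurable_component_singleton) auto
  show ?case by (simp add: mixture_def recursive_estimate.simps(2)) measurable
qed

lemma mixture_est_measurable: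
  assumes "{1..n} \<subseteq> I"
  shows "(\<lambda>(h, x). mixture \<mu> k (est n h) x) \<in> borel_measurable (Pi\<^sub>M I (\<lambda>_. \<nu>) \<Otimes>\<^sub>M \<nu>)"
proof -
  note est_measurable[OF assms, measurable]
  show ?thesis unfolding mixture_def by measurable
qed

text \<open>Independence of the next observation from the history. The singleton family \<open>Y\<close> stands
  for the next observation in order to have the type of the history.\<close>

lemma nn_integral_hist_next:
  assumes u[measurable]: "case_prod u \<in> borel_measurable (hist_space n \<Otimes>\<^sub>M \<nu>)"
  shows "(\<integral>\<^sup>+\<omega>. u (hist n \<omega>) (X (Suc n) \<omega>) \<partial>M) = (\<integral>\<^sup>+\<omega>. (\<integral>\<^sup>+x. u (hist n \<omega>) x \<partial>P) \<partial>M)"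
proof -
  define Y where "Y \<omega> = restrict (\<lambda>i. X i \<omega>) {Suc n}" for \<omega>
  let ?N = "Pi\<^sub>M {Suc n} (\<lambda>_. \<nu>)"
  have [measurable]: "Y \<in> measurable M ?N" unfolding Y_def[abs_def] by measurable
  have [measurable]: "(\<lambda>y. y (Suc n)) \<in> measurable ?N \<nu>" by measurable
  have "M.indep_var (hist_space n) (hist n) ?N Y"
    unfolding hist_def[abs_def] Y_def[abs_def] by (rule M.indep_var_restrict[OF X_indep]) auto
  then have joint: "distr M (hist_space n) (hist n) \<Otimes>\<^sub>M distr M ?N Y
      = distr M (hist_space n \<Otimes>\<^sub>M ?N) (\<lambda>\<omega>. (hist n \<omega>, Y \<omega>))"
    unfolding M.indep_var_distribution_eq by simp
  interpret Y: prob_space "distr M ?N Y" by (rule M.prob_space_distr) measurable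
  have "(\<integral>\<^sup>+\<omega>. u (hist n \<omega>) (X (Suc n) \<omega>) \<partial>M)
    = (\<integral>\<^sup>+\<omega>. u (hist n \<omega>) (Y \<omega> (Suc n)) \<partial>M)" by (simp add: Y_def)
  also have "\<dots> = (\<integral>\<^sup>+z. u (fst z) (snd z (Suc n)) \<partial>distr M (hist_space n \<Otimes>\<^sub>M ?N) (\<lambda>\<omega>. (hist n \<omega>, Y \<omega>)))"
    by (subst nn_integral_distr; (measurable | simp))
  also have "\<dots> = (\<integral>\<^sup>+h. (\<integral>\<^sup>+y. u h (y (Suc n)) \<partial>distr M ?N Y) \<partial>distr M (hist_space n) (hist n))"
    unfolding joint[symmetric] by (subst Y.nn_integral_fst[symmetric]; (measurable | simp))
  also have "\<dots> = (\<integral>\<^sup>+\<omega>. (\<integral>\<^sup>+y. u (hist n \<omega>) (y (Suc n)) \<partial>distr M ?N Y) \<partial>M)"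
    by (subst nn_integral_distr; (measurable | simp))
  also have "\<dots> = (\<integral>\<^sup>+\<omega>. (\<integral>\<^sup>+x. u (hist n \<omega>) x \<partial>P) \<partial>M)"
  proof (rule nn_integral_cong)
    fix \<omega> assume "\<omega> \<in> space M"
    then have "hist n \<omega> \<in> space (hist_space n)" by (rule measurable_space[OF hist_measurable])
    then have [measurable]: "u (hist n \<omega>) \<in> borel_measurable \<nu>" by measurable
    have "(\<integral>\<^sup>+y. u (hist n \<omega>) (y (Suc n)) \<partial>distr M ?N Y) = (\<integral>\<^sup>+\<omega>'. u (hist n \<omega>) (X (Suc n) \<omega>') \<partial>M)"
      by (subst nn_integral_distr) (auto simp: Y_def)
    also have "\<dots> = (\<integral>\<^sup>+x. u (hist n \<omega>) x \<partial>distr M \<nu> (X (Suc n)))"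
      by (subst nn_integral_distr) auto
    finally show "(\<integral>\<^sup>+y. u (hist n \<omega>) (y (Suc n)) \<partial>distr M ?N Y) = (\<integral>\<^sup>+x. u (hist n \<omega>) x \<partial>P)"
      by (simp add: X_distr)
  qed
  finally show ?thesis .
qed

text \<open>Conditioning on the first \<open>n\<close> observations: the next estimate is integrated over a fresh
  observation, on an arbitrary event \<open>A\<close> of the history.\<close>

lemma nn_integral_est_Suc:
  fixes \<Phi> :: "('t \<Rightarrow> real) \<Rightarrow> ennreal"
  assumes [measurable]: "(\<lambda>h. \<Phi> (est (Suc n) h)) \<in> borel_measurable (hist_space (Suc n))"
    and A[measurable]: "A \<in> sets (hist_space n)"
  shows "(\<integral>\<^sup>+\<omega>. \<Phi> (est (Suc n) (\<lambda>i. X i \<omega>)) * indicator A (hist n \<omega>) \<partial>M)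
    = (\<integral>\<^sup>+\<omega>. (\<integral>\<^sup>+x. \<Phi> (pr_step (w (Suc n)) (est n (\<lambda>i. X i \<omega>)) x) \<partial>P) * indicator A (hist n \<omega>) \<partial>M)"
proof -
  define u where "u h x = \<Phi> (est (Suc n) (h(Suc n := x))) * indicator A h" for h x
  have upd: "(\<lambda>(h, x). h(Suc n := x)) \<in> measurable (hist_space n \<Otimes>\<^sub>M \<nu>) (hist_space (Suc n))"
    using measurable_add_dim[of "Suc n" "{1..n}" "\<lambda>_. \<nu>"] by (simp add: atLeastAtMostSuc_conv)
  have \<Phi>_meas: "(\<lambda>(h, x). \<Phi> (est (Suc n) (h(Suc n := x)))) \<in> borel_measurable (hist_space n \<Otimes>\<^sub>M \<nu>)"
    using measurable_compose[OF upd assms(1)] by (simp add: case_prod_beta)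
  then have u_meas: "case_prod u \<in> borel_measurable (hist_space n \<Otimes>\<^sub>M \<nu>)"
    unfolding u_def[abs_def] case_prod_beta by measurable
  have "(\<integral>\<^sup>+\<omega>. \<Phi> (est (Suc n) (\<lambda>i. X i \<omega>)) * indicator A (hist n \<omega>) \<partial>M)
    = (\<integral>\<^sup>+\<omega>. u (hist n \<omega>) (X (Suc n) \<omega>) \<partial>M)"
  proof (rule nn_integral_cong)
    fix \<omega>
    have "est (Suc n) ((hist n \<omega>)(Suc n := X (Suc n) \<omega>)) = est (Suc n) (\<lambda>i. X i \<omega>)"
      by (rule recursive_estimate_cong) (auto simp: hist_def)
    then show "\<Phi> (est (Suc n) (\<lambda>i. X i \<omega>)) * indicator A (hist n \<omega>) = u (hist n \<omega>) (X (Suc n) \<omega>)"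
      by (simp only: u_def)
  qed
  also have "\<dots> = (\<integral>\<^sup>+\<omega>. (\<integral>\<^sup>+x. u (hist n \<omega>) x \<partial>P) \<partial>M)" by (rule nn_integral_hist_next[OF u_meas])
  also have "\<dots> = (\<integral>\<^sup>+\<omega>. (\<integral>\<^sup>+x. \<Phi> (pr_step (w (Suc n)) (est n (\<lambda>i. X i \<omega>)) x) \<partial>P) * indicator A (hist n \<omega>) \<partial>M)"
  proof (rule nn_integral_cong)
    fix \<omega> assume "\<omega> \<in> space M"
    show "(\<integral>\<^sup>+x. u (hist n \<omega>) x \<partial>P) = (\<integral>\<^sup>+x. \<Phi> (pr_step (w (Suc n)) (est n (\<lambda>i. X i \<omega>)) x) \<partial>P) * indicator A (hist n \<omega>)"
      unfolding u_def est_fun_upd est_hist by (cases "hist n \<omega> \<in> A") simp_all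
  qed
  finally show ?thesis .
qed

text \<open>The properties of the current estimate on which the one-step bounds rest. Both
  survive an update at an observation where the current mixture is positive.\<close>

definition regular :: "('t \<Rightarrow> real) \<Rightarrow> bool" where
  "regular g \<longleftrightarrow> prob_density_on \<mu> g \<and> (AE \<theta> in \<mu>. 0 < f \<theta> \<longrightarrow> 0 < g \<theta>)"

lemma w_less_1: "i \<ge> 1 \<Longrightarrow> w i < 1" and w_le_1: "i \<ge> 1 \<Longrightarrow> w i \<le> 1"
  using w_bounds[of i] \<delta>_pos by linarith+

lemma regular_pr_step:
  assumes g: "regular g" and x: "x \<in> space \<nu>" "0 < mixture \<mu> k g x" and i: "i \<ge> 1"
  shows "regular (pr_step (w i) g x)"
proof -
  have d: "prob_density_on \<mu> g" and s: "AE \<theta> in \<mu>. 0 < f \<theta> \<longrightarrow> 0 < g \<theta>" using g by (auto simp: regular_def)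
  note r = posterior_density[OF d x]
  have "AE \<theta> in \<mu>. 0 < f \<theta> \<longrightarrow> 0 < pr_step (w i) g x \<theta>"
    using s AE_space
  proof eventually_elim
    case (elim \<theta>)
    then show ?case
      using w_less_1[OF i] w_bounds(1)[OF i] prob_density_onD(2)[OF r elim(2)]
      by (auto simp: pr_step_def intro!: add_pos_nonneg mult_pos_pos)
  qed
  then show ?thesis
    using pr_step_density[OF d x w_bounds(1)[OF i] w_le_1[OF i]] by (simp add: regular_def)
qed

text \<open>The current mixture is positive almost everywhere where the true one is
  (\<open>mixture_pos_AE\<close>), so the next observation almost surely avoids a division by zero.\<close>

lemma est_regular: "AE \<omega> in M. regular (est n (\<lambda>i. X i \<omega>))"
proof (induction n)
  case 0
  show ?case using f0_density f0_support by (simp add: regular_def)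
next
  case (Suc n)
  define u :: "(nat \<Rightarrow> 'x) \<Rightarrow> 'x \<Rightarrow> ennreal"
    where "u h x = indicator {t. t \<le> 0} (mixture \<mu> k (est n h) x)" for h x
  note [measurable] = mixture_est_measurable[OF order_refl, of n]
  have u: "case_prod u \<in> borel_measurable (hist_space n \<Otimes>\<^sub>M \<nu>)" unfolding u_def[abs_def] by measurable
  have u\<nu>: "u (hist n \<omega>) \<in> borel_measurable \<nu>" if "\<omega> \<in> space M" for \<omega>
  proof -
    have "hist n \<omega> \<in> space (hist_space n)" using that by (rule measurable_space[OF hist_measurable])
    then show ?thesis using u by measurable
  qed
  have "(\<integral>\<^sup>+\<omega>. u (hist n \<omega>) (X (Suc n) \<omega>) \<partial>M) = (\<integral>\<^sup>+\<omega>. (\<integral>\<^sup>+x. u (hist n \<omega>) x \<partial>P) \<partial>M)"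
    by (rule nn_integral_hist_next[OF u])
  also have "\<dots> = (\<integral>\<^sup>+\<omega>. 0 \<partial>M)"
  proof (rule nn_integral_cong_AE, use Suc AE_space in eventually_elim)
    case (elim \<omega>)
    then have g: "prob_density_on \<mu> (est n (hist n \<omega>))" by (simp add: regular_def est_hist)
    have "AE x in \<nu>. ennreal (mixture \<mu> k f x) * u (hist n \<omega>) x = 0"
      using mixture_pos_AE[OF f_density g] AE_space
    proof eventually_elim
      case (elim x)
      then show ?case using prob_density_onD(2)[OF mixture_density[OF f_density] elim(2)]
        by (auto simp: u_def less_le indicator_def)
    qed
    then have "(\<integral>\<^sup>+x. ennreal (mixture \<mu> k f x) * u (hist n \<omega>) x \<partial>\<nu>) = (\<integral>\<^sup>+x. 0 \<partial>\<nu>)"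
      by (rule nn_integral_cong_AE)
    then show ?case using nn_integral_mixture_density[OF f_density u\<nu>[OF elim(2)]] by simp
  qed
  finally have "(\<integral>\<^sup>+\<omega>. u (hist n \<omega>) (X (Suc n) \<omega>) \<partial>M) = 0" by simp
  moreover have "(\<lambda>\<omega>. u (hist n \<omega>) (X (Suc n) \<omega>)) \<in> borel_measurable M"
    using measurable_compose[OF measurable_Pair[OF hist_measurable X_measurable] u, of "Suc n"] by simp
  ultimately have "AE \<omega> in M. u (hist n \<omega>) (X (Suc n) \<omega>) = 0" by (simp add: nn_integral_0_iff_AE)
  then show ?case
    using Suc AE_space
  proof eventually_elim
    case (elim \<omega>)
    have "0 < mixture \<mu> k (est n (\<lambda>i. X i \<omega>)) (X (Suc n) \<omega>)"
      using elim(1) by (auto simp: u_def est_hist indicator_def split: if_splits)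
    moreover have "X (Suc n) \<omega> \<in> space \<nu>" using elim(3) by (intro measurable_space[OF X_measurable]) simp_all
    ultimately show ?case unfolding est_Suc using elim(2) by (intro regular_pr_step) auto
  qed
qed

abbreviation KL :: "('t \<Rightarrow> real) \<Rightarrow> ennreal" where
  "KL g \<equiv> gen_kl \<nu> (mixture \<mu> k f) (mixture \<mu> k g)"

abbreviation restricted_KL :: "'t set \<Rightarrow> ('t \<Rightarrow> real) \<Rightarrow> ennreal" where
  "restricted_KL A g \<equiv> gen_kl \<mu> (\<lambda>\<theta>. f \<theta> * indicator A \<theta>) g"

abbreviation f_mass :: "'t set \<Rightarrow> ennreal" where
  "f_mass A \<equiv> \<integral>\<^sup>+\<theta>. ennreal (f \<theta>) * indicator A \<theta> \<partial>\<mu>"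

lemma KL_est_measurable[measurable]: "(\<lambda>h. KL (est n h)) \<in> borel_measurable (hist_space n)"
proof -
  note [measurable] = mixture_est_measurable[OF order_refl, of n] prob_density_onD(1)[OF f_density]
  show ?thesis unfolding gen_kl_def by measurable
qed

lemma restricted_KL_est_measurable[measurable]:
  assumes [measurable]: "A \<in> sets \<mu>"
  shows "(\<lambda>h. restricted_KL A (est n h)) \<in> borel_measurable (hist_space n)"
proof -
  note [measurable] = est_measurable[OF order_refl, of n] prob_density_onD(1)[OF f_density]
  show ?thesis unfolding gen_kl_def by measurable
qed

lemma KL_est_random_variable[measurable]: "(\<lambda>\<omega>. KL (est n (\<lambda>i. X i \<omega>))) \<in> borel_measurable M"
  using measurable_compose[OF hist_measurable KL_est_measurable] by (simp add: est_hist)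

lemma restricted_KL_est_random_variable[measurable]:
  "A \<in> sets \<mu> \<Longrightarrow> (\<lambda>\<omega>. restricted_KL A (est n (\<lambda>i. X i \<omega>))) \<in> borel_measurable M"
  using measurable_compose[OF hist_measurable restricted_KL_est_measurable] by (simp add: est_hist)

lemma KL_almost_supermartingale:
  assumes A: "A \<in> sets (hist_space n)"
  shows "(\<integral>\<^sup>+\<omega>. KL (est (Suc n) (\<lambda>i. X i \<omega>)) * indicator A (hist n \<omega>) \<partial>M)
    \<le> (\<integral>\<^sup>+\<omega>. (KL (est n (\<lambda>i. X i \<omega>)) + ennreal ((w (Suc n))\<^sup>2 * ((B + 1) / \<delta>))) * indicator A (hist n \<omega>) \<partial>M)"
  unfolding nn_integral_est_Suc[where \<Phi> = KL, OF KL_est_measurable A]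
proof (rule nn_integral_mono_AE, use est_regular[of n] in eventually_elim)
  case (elim \<omega>)
  then show ?case
    by (intro mult_right_mono kl_step_expectation f_density \<delta>_pos w_bounds) (auto simp: regular_def)
qed

lemma restricted_KL_dissipation:
  assumes A[measurable]: "A \<in> sets \<mu>"
  shows "(\<integral>\<^sup>+\<omega>. restricted_KL A (est (Suc n) (\<lambda>i. X i \<omega>)) \<partial>M)
      + ennreal (w (Suc n)) * (\<integral>\<^sup>+\<omega>. KL (est n (\<lambda>i. X i \<omega>)) \<partial>M)
    \<le> (\<integral>\<^sup>+\<omega>. restricted_KL A (est n (\<lambda>i. X i \<omega>)) \<partial>M)
      + ennreal (w (Suc n)) * (ennreal (B + 1) * f_mass (space \<mu> - A))
      + ennreal ((w (Suc n))\<^sup>2 * ((B + 1) / \<delta>))"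
proof -
  let ?S = "\<lambda>\<omega> i. X i \<omega>"
  let ?D = "\<lambda>\<omega>. \<integral>\<^sup>+x. restricted_KL A (pr_step (w (Suc n)) (est n (?S \<omega>)) x) \<partial>P"
  have ind: "indicator (space (hist_space n)) (hist n \<omega>) = (1 :: ennreal)" if "\<omega> \<in> space M" for \<omega>
    using measurable_space[OF hist_measurable that] by simp
  have "(\<integral>\<^sup>+\<omega>. restricted_KL A (est (Suc n) (?S \<omega>)) \<partial>M)
      = (\<integral>\<^sup>+\<omega>. restricted_KL A (est (Suc n) (?S \<omega>)) * indicator (space (hist_space n)) (hist n \<omega>) \<partial>M)"
    by (intro nn_integral_cong) (simp only: ind mult_1_right)
  also have "\<dots> = (\<integral>\<^sup>+\<omega>. ?D \<omega> * indicator (space (hist_space n)) (hist n \<omega>) \<partial>M)"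
    by (rule nn_integral_est_Suc[where \<Phi> = "restricted_KL A", OF restricted_KL_est_measurable[OF A] sets.top])
  also have "\<dots> = (\<integral>\<^sup>+\<omega>. ?D \<omega> \<partial>M)" by (intro nn_integral_cong) (simp only: ind mult_1_right)
  finally have D: "(\<integral>\<^sup>+\<omega>. restricted_KL A (est (Suc n) (?S \<omega>)) \<partial>M) = (\<integral>\<^sup>+\<omega>. ?D \<omega> \<partial>M)" .
  have D_meas[measurable]: "?D \<in> borel_measurable M"
  proof -
    note [measurable] = est_measurable[OF order_refl, of n] mixture_est_measurable[OF order_refl, of n]
      prob_density_onD(1)[OF f_density]
    interpret P: prob_space P
      using prob_space_density_of_prob_density_on[OF mixture_density[OF f_density]] .
    have "(\<lambda>h. \<integral>\<^sup>+x. restricted_KL A (pr_step (w (Suc n)) (est n h) x) \<partial>P) \<in> borel_measurable (hist_space n)"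
      unfolding gen_kl_def pr_step_def posterior_def by measurable
    from measurable_compose[OF hist_measurable this] show ?thesis by (simp add: est_hist)
  qed
  have "(\<integral>\<^sup>+\<omega>. restricted_KL A (est (Suc n) (?S \<omega>)) \<partial>M)
      + ennreal (w (Suc n)) * (\<integral>\<^sup>+\<omega>. KL (est n (?S \<omega>)) \<partial>M)
    = (\<integral>\<^sup>+\<omega>. ?D \<omega> + ennreal (w (Suc n)) * KL (est n (?S \<omega>)) \<partial>M)"
    unfolding D by (simp add: nn_integral_add nn_integral_cmult)
  also have "\<dots> \<le> (\<integral>\<^sup>+\<omega>. restricted_KL A (est n (?S \<omega>))
      + ennreal (w (Suc n)) * (ennreal (B + 1) * f_mass (space \<mu> - A))
      + ennreal ((w (Suc n))\<^sup>2 * ((B + 1) / \<delta>)) \<partial>M)"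
  proof (rule nn_integral_mono_AE, use est_regular[of n] in eventually_elim)
    case (elim \<omega>)
    then have "AE \<theta> in \<mu>. 0 < f \<theta> * indicator A \<theta> \<longrightarrow> 0 < est n (?S \<omega>) \<theta>"
      unfolding regular_def by (auto elim!: eventually_mono simp: indicator_def)
    with elim show ?case
      by (intro mixing_kl_step_expectation f_density A \<delta>_pos w_bounds) (auto simp: regular_def)
  qed
  also have "\<dots> = (\<integral>\<^sup>+\<omega>. restricted_KL A (est n (?S \<omega>)) \<partial>M)
      + ennreal (w (Suc n)) * (ennreal (B + 1) * f_mass (space \<mu> - A))
      + ennreal ((w (Suc n))\<^sup>2 * ((B + 1) / \<delta>))"
    by (simp add: nn_integral_add M.emeasure_space_1)
  finally show ?thesis .
qed

lemma KL_initial_finite: "KL f0 \<le> ennreal (B + 1)"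
proof -
  note d = mixture_density[OF f_density] mixture_density[OF f0_density]
  have "KL f0 \<le> KL f0 + 1" by simp
  also have "\<dots> \<le> (\<integral>\<^sup>+x. ennreal ((mixture \<mu> k f x)\<^sup>2 / mixture \<mu> k f0 x) \<partial>\<nu>)"
    by (rule gen_kl_le_chi_square)
      (auto intro: mixture_pos_AE f_density f0_density prob_density_onD[OF d(1)] prob_density_onD[OF d(2)])
  also have "\<dots> \<le> (\<integral>\<^sup>+x. ennreal (mixture \<mu> k f x * ((mixture \<mu> k f x / mixture \<mu> k f0 x)\<^sup>2 + 1)) \<partial>\<nu>)"
  proof (intro nn_integral_mono ennreal_leI)
    fix x assume x: "x \<in> space \<nu>"
    define t where "t = mixture \<mu> k f x / mixture \<mu> k f0 x"
    have "mixture \<mu> k f x * t \<le> mixture \<mu> k f x * (t\<^sup>2 + 1)"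
      using le_square_plus_1 prob_density_onD(2)[OF d(1) x] by (rule mult_left_mono)
    then show "(mixture \<mu> k f x)\<^sup>2 / mixture \<mu> k f0 x \<le> mixture \<mu> k f x * ((mixture \<mu> k f x / mixture \<mu> k f0 x)\<^sup>2 + 1)"
      unfolding t_def by (simp add: power2_eq_square)
  qed
  also have "\<dots> \<le> ennreal (B + 1)" by (rule weighted_ratio_moment[OF f_density f0_density f_density])
  finally show ?thesis .
qed

text \<open>On \<open>{f \<le> T f0}\<close> the logarithm in the divergence is at most \<open>ln T\<close>. The complements
  shrink to a set where \<open>f > 0 = f0\<close>, which is null by the support condition on \<open>f0\<close>.\<close>

lemma exists_truncation:
  assumes "0 < \<epsilon>"
  obtains A where "A \<in> sets \<mu>" "ennreal (B + 1) * f_mass (space \<mu> - A) \<le> ennreal \<epsilon>"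
    "restricted_KL A f0 < top"
proof -
  note [measurable] = prob_density_onD(1)[OF f_density] prob_density_onD(1)[OF f0_density]
  note f_nonneg = prob_density_onD(2)[OF f_density] and f0_nonneg = prob_density_onD(2)[OF f0_density]
  define A where "A n = {\<theta> \<in> space \<mu>. f \<theta> \<le> real (Suc n) * f0 \<theta>}" for n
  have A[measurable]: "A n \<in> sets \<mu>" for n unfolding A_def by measurable
  have "(\<lambda>n. f_mass (space \<mu> - A n)) \<longlonglongrightarrow> (\<integral>\<^sup>+\<theta>. 0 \<partial>\<mu>)"
  proof (rule nn_integral_dominated_convergence[where w = "\<lambda>\<theta>. ennreal (f \<theta>)"])
    show "(\<integral>\<^sup>+\<theta>. ennreal (f \<theta>) \<partial>\<mu>) < \<infinity>" by (simp add: prob_density_onD(3)[OF f_density])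
    show "AE \<theta> in \<mu>. (\<lambda>n. ennreal (f \<theta>) * indicator (space \<mu> - A n) \<theta>) \<longlonglongrightarrow> 0"
      using f0_support AE_space
    proof eventually_elim
      case (elim \<theta>)
      show ?case
      proof (cases "f \<theta> = 0")
        case False
        with elim f_nonneg[of \<theta>] have pos: "0 < f0 \<theta>" by auto
        obtain N :: nat where N: "f \<theta> / f0 \<theta> \<le> real N" using real_arch_simple by blast
        have "\<theta> \<in> A n" if "n \<ge> N" for n
        proof -
          have "f \<theta> \<le> real N * f0 \<theta>" using N pos by (simp add: field_simps)
          also have "\<dots> \<le> real (Suc n) * f0 \<theta>" using that pos by (intro mult_right_mono) auto
          finally show ?thesis using elim by (simp add: A_def)
        qed
        then have "\<forall>\<^sub>F n in sequentially. ennreal (f \<theta>) * indicator (space \<mu> - A n) \<theta> = 0"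
          by (intro eventually_sequentiallyI[of N]) simp
        then show ?thesis by (rule tendsto_eventually)
      qed simp
    qed
  qed (auto simp: indicator_def)
  then have "(\<lambda>n. ennreal (B + 1) * f_mass (space \<mu> - A n)) \<longlonglongrightarrow> ennreal (B + 1) * 0"
    by (intro ennreal_tendsto_cmult) auto
  then have "\<forall>\<^sub>F n in sequentially. ennreal (B + 1) * f_mass (space \<mu> - A n) < ennreal \<epsilon>"
    by (rule order_tendstoD) (use assms in simp)
  then obtain n where n: "ennreal (B + 1) * f_mass (space \<mu> - A n) < ennreal \<epsilon>"
    by (auto simp: eventually_sequentially)
  let ?L = "ln (real (Suc n))"
  have "restricted_KL (A n) f0 \<le> (\<integral>\<^sup>+\<theta>. ennreal ?L * ennreal (f \<theta>) + ennreal (f0 \<theta>) \<partial>\<mu>)"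
    unfolding gen_kl_def
  proof (rule nn_integral_mono_AE, use f0_support AE_space in eventually_elim)
    case (elim \<theta>)
    let ?\<phi> = "f \<theta> * indicator (A n) \<theta>"
    have L0: "0 \<le> ?L" by simp
    have "?\<phi> * ln (?\<phi> / f0 \<theta>) - ?\<phi> + f0 \<theta> \<le> ?L * f \<theta> + f0 \<theta>"
    proof (cases "?\<phi> = 0")
      case False
      with elim f_nonneg[of \<theta>] have a: "\<theta> \<in> A n" "0 < f \<theta>" "0 < f0 \<theta>"
        by (auto simp: indicator_def split: if_splits)
      then have "f \<theta> / f0 \<theta> \<le> real (Suc n)" by (simp add: A_def field_simps)
      then have "ln (f \<theta> / f0 \<theta>) \<le> ?L" using a by (subst ln_le_cancel_iff) auto
      then have "f \<theta> * ln (f \<theta> / f0 \<theta>) \<le> f \<theta> * ?L" using a by (intro mult_left_mono) auto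
      then have "f \<theta> * ln (f \<theta> / f0 \<theta>) - f \<theta> + f0 \<theta> \<le> ?L * f \<theta> + f0 \<theta>"
        unfolding mult.commute[of ?L] using a by linarith
      then show ?thesis using a(1) by simp
    qed (use f_nonneg[OF elim(2)] L0 in \<open>auto intro: mult_nonneg_nonneg\<close>)
    then have "ennreal (?\<phi> * ln (?\<phi> / f0 \<theta>) - ?\<phi> + f0 \<theta>) \<le> ennreal (?L * f \<theta> + f0 \<theta>)" by (rule ennreal_leI)
    also have "\<dots> = ennreal ?L * ennreal (f \<theta>) + ennreal (f0 \<theta>)"
      using f_nonneg[OF elim(2)] f0_nonneg[OF elim(2)] L0
      by (subst ennreal_plus) (auto simp: ennreal_mult)
    finally show ?case .
  qed
  also have "\<dots> = ennreal ?L + 1"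
    by (simp add: nn_integral_add nn_integral_cmult prob_density_onD(3)[OF f_density]
        prob_density_onD(3)[OF f0_density])
  also have "\<dots> < top" by simp
  finally show ?thesis using n by (intro that[of "A n"]) auto
qed

lemma B1_pos: "0 \<le> (B + 1) / \<delta>"
  using B_nonneg \<delta>_pos by simp

lemma expected_KL_step:
  "(\<integral>\<^sup>+\<omega>. KL (est (Suc n) (\<lambda>i. X i \<omega>)) \<partial>M)
    \<le> (\<integral>\<^sup>+\<omega>. KL (est n (\<lambda>i. X i \<omega>)) \<partial>M) + ennreal ((w (Suc n))\<^sup>2 * ((B + 1) / \<delta>))"
proof -
  have ind: "indicator (space (hist_space n)) (hist n \<omega>) = (1 :: ennreal)" if "\<omega> \<in> space M" for \<omega>
    using measurable_space[OF hist_measurable that] by simp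
  have "(\<integral>\<^sup>+\<omega>. KL (est (Suc n) (\<lambda>i. X i \<omega>)) \<partial>M)
      = (\<integral>\<^sup>+\<omega>. KL (est (Suc n) (\<lambda>i. X i \<omega>)) * indicator (space (hist_space n)) (hist n \<omega>) \<partial>M)"
    by (intro nn_integral_cong) (simp only: ind mult_1_right)
  also note KL_almost_supermartingale[OF sets.top]
  also have "(\<integral>\<^sup>+\<omega>. (KL (est n (\<lambda>i. X i \<omega>)) + ennreal ((w (Suc n))\<^sup>2 * ((B + 1) / \<delta>)))
      * indicator (space (hist_space n)) (hist n \<omega>) \<partial>M)
    = (\<integral>\<^sup>+\<omega>. KL (est n (\<lambda>i. X i \<omega>)) + ennreal ((w (Suc n))\<^sup>2 * ((B + 1) / \<delta>)) \<partial>M)"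
    by (intro nn_integral_cong) (simp only: ind mult_1_right)
  also have "\<dots> = (\<integral>\<^sup>+\<omega>. KL (est n (\<lambda>i. X i \<omega>)) \<partial>M) + ennreal ((w (Suc n))\<^sup>2 * ((B + 1) / \<delta>))"
    by (simp add: nn_integral_add M.emeasure_space_1)
  finally show ?thesis .
qed

text \<open>The potential \<open>d\<close> of \<open>tendsto_0_of_dissipation\<close> is the expected divergence of the
  truncated \<open>f\<close> from the estimate, for a truncation whose loss is at most \<open>\<epsilon>\<close>.\<close>

lemma expected_KL_tendsto_0:
  assumes w_sq: "summable (\<lambda>i. (w (Suc i))\<^sup>2)"
    and w_div: "filterlim (\<lambda>n. \<Sum>i<n. w (Suc i)) at_top sequentially"
  shows "(\<lambda>n. \<integral>\<^sup>+\<omega>. KL (est n (\<lambda>i. X i \<omega>)) \<partial>M) \<longlonglongrightarrow> 0"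
proof -
  define C where "C = (B + 1) / \<delta>"
  have C: "0 \<le> C" unfolding C_def by (rule B1_pos)
  define E where "E n = (\<integral>\<^sup>+\<omega>. KL (est n (\<lambda>i. X i \<omega>)) \<partial>M)" for n
  have step: "E (Suc n) \<le> E n + ennreal (C * (w (Suc n))\<^sup>2)" for n
    using expected_KL_step[of n] by (simp add: E_def C_def mult.commute)
  have E_fin: "E n < top" for n
  proof (induction n)
    case 0
    have "E 0 = KL f0" by (simp add: E_def M.emeasure_space_1)
    then show ?case using KL_initial_finite by (metis ennreal_less_top le_less_trans)
  next
    case (Suc n) then show ?case using step[of n] by (metis ennreal_add_less_top ennreal_less_top le_less_trans)
  qed
  define e where "e n = enn2real (E n)" for n
  have e: "E n = ennreal (e n)" "0 \<le> e n" for n using E_fin[of n] by (auto simp: e_def)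
  have "e \<longlonglongrightarrow> 0"
  proof (rule tendsto_0_of_dissipation[where w = "\<lambda>n. w (Suc n)" and C = C])
    show "e (Suc n) \<le> e n + C * (w (Suc n))\<^sup>2" for n
      using step[of n] e(2) C by (simp add: e(1) flip: ennreal_plus)
    fix \<epsilon> :: real assume \<epsilon>: "0 < \<epsilon>"
    then obtain A where A: "A \<in> sets \<mu>" "ennreal (B + 1) * f_mass (space \<mu> - A) \<le> ennreal \<epsilon>"
      "restricted_KL A f0 < top" by (rule exists_truncation)
    define D where "D n = (\<integral>\<^sup>+\<omega>. restricted_KL A (est n (\<lambda>i. X i \<omega>)) \<partial>M)" for n
    have D_step: "D (Suc n) + ennreal (w (Suc n)) * E n
      \<le> D n + ennreal (w (Suc n)) * ennreal \<epsilon> + ennreal (C * (w (Suc n))\<^sup>2)" for n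
    proof -
      have "D (Suc n) + ennreal (w (Suc n)) * E n
        \<le> D n + ennreal (w (Suc n)) * (ennreal (B + 1) * f_mass (space \<mu> - A)) + ennreal (C * (w (Suc n))\<^sup>2)"
        using restricted_KL_dissipation[OF A(1), of n] by (simp add: D_def E_def C_def mult.commute)
      also have "\<dots> \<le> D n + ennreal (w (Suc n)) * ennreal \<epsilon> + ennreal (C * (w (Suc n))\<^sup>2)"
        by (intro add_right_mono add_left_mono mult_left_mono A(2)) simp
      finally show ?thesis .
    qed
    have D_fin: "D n < top" for n
    proof (induction n)
      case 0
      show ?case using A(3) by (simp add: D_def M.emeasure_space_1)
    next
      case (Suc n)
      have "D (Suc n) \<le> D (Suc n) + ennreal (w (Suc n)) * E n" by simp
      also note D_step[of n]
      also have "D n + ennreal (w (Suc n)) * ennreal \<epsilon> + ennreal (C * (w (Suc n))\<^sup>2) < top"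
        using Suc by (simp add: ennreal_mult_less_top)
      finally show ?case .
    qed
    define d where "d n = enn2real (D n)" for n
    have d: "D n = ennreal (d n)" "0 \<le> d n" for n using D_fin[of n] by (auto simp: d_def)
    have "d (Suc n) + w (Suc n) * e n \<le> d n + w (Suc n) * \<epsilon> + C * (w (Suc n))\<^sup>2" for n
    proof -
      have "ennreal (d (Suc n) + w (Suc n) * e n) \<le> ennreal (d n + w (Suc n) * \<epsilon> + C * (w (Suc n))\<^sup>2)"
        using D_step[of n] \<epsilon> C d(2) e(2) w_bounds(1)[of "Suc n"]
        by (simp add: d(1) e(1) ennreal_mult)
      then show ?thesis
        using \<epsilon> C d(2)[of n] w_bounds(1)[of "Suc n"] by (subst (asm) ennreal_le_iff) auto
    qed
    then show "\<exists>d. (\<forall>n. 0 \<le> d n) \<and>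
      (\<forall>n. d (Suc n) + w (Suc n) * e n \<le> d n + w (Suc n) * \<epsilon> + C * (w (Suc n))\<^sup>2)"
      using d(2) by blast
  qed (use e(2) C w_bounds w_sq w_div in auto)
  then have "(\<lambda>n. ennreal (e n)) \<longlonglongrightarrow> ennreal 0" by (rule tendsto_ennrealI)
  then show ?thesis by (simp add: e(1)[symmetric] E_def)
qed

text \<open>Adding the tail \<open>R n\<close> of the error series turns the almost supermartingale into a true one
  for the filtration generated by the observations.\<close>

lemma AE_KL_tendsto_0:
  assumes w_sq: "summable (\<lambda>i. (w (Suc i))\<^sup>2)"
    and w_div: "filterlim (\<lambda>n. \<Sum>i<n. w (Suc i)) at_top sequentially"
  shows "AE \<omega> in M. (\<lambda>n. KL (est n (\<lambda>i. X i \<omega>))) \<longlonglongrightarrow> 0"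
proof -
  define C where "C = (B + 1) / \<delta>"
  have C: "0 \<le> C" unfolding C_def by (rule B1_pos)
  define R where "R n = C * ((\<Sum>i. (w (Suc i))\<^sup>2) - (\<Sum>i<n. (w (Suc i))\<^sup>2))" for n
  have R0: "0 \<le> R n" for n
    unfolding R_def using C sum_le_suminf[OF w_sq, of "{..<n}"] by simp
  have R_Suc: "R n = C * (w (Suc n))\<^sup>2 + R (Suc n)" for n by (simp add: R_def algebra_simps)
  have "R \<longlonglongrightarrow> C * ((\<Sum>i. (w (Suc i))\<^sup>2) - (\<Sum>i. (w (Suc i))\<^sup>2))"
    unfolding R_def by (intro tendsto_intros summable_LIMSEQ w_sq)
  then have R_lim: "(\<lambda>n. ennreal (R n)) \<longlonglongrightarrow> 0" using tendsto_ennrealI[of R 0] by simp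
  define V where "V n \<omega> = KL (est n (\<lambda>i. X i \<omega>)) + ennreal (R n)" for n \<omega>
  define F where "F n = vimage_algebra (space M) (hist n) (hist_space n)" for n
  have hist_in: "hist n \<in> space M \<rightarrow> space (hist_space n)" for n
    using measurable_space[OF hist_measurable] by auto
  have F_sets: "sets (F n) = {hist n -` A \<inter> space M |A. A \<in> sets (hist_space n)}" for n
    unfolding F_def by (rule sets_vimage_algebra2[OF hist_in])
  have hist_F: "hist n \<in> measurable (F n) (hist_space n)" for n
    unfolding F_def by (rule measurable_vimage_algebra1[OF hist_in])
  have spF: "space (F n) = space M" for n by (simp add: F_def)
  have "AE \<omega> in M. (\<lambda>n. V n \<omega>) \<longlonglongrightarrow> 0"
  proof (rule nonneg_supermartingale_AE_tendsto_0[where F = F])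
    show "subalgebra M (F n)" for n
      unfolding subalgebra_def F_sets spF using measurable_sets[OF hist_measurable] by auto
    show "subalgebra (F (Suc n)) (F n)" for n
    proof -
      have "(\<lambda>\<omega>. restrict (hist (Suc n) \<omega>) {1..n}) \<in> measurable (F (Suc n)) (hist_space n)"
        by (rule measurable_compose[OF hist_F measurable_restrict_subset]) auto
      moreover have "(\<lambda>\<omega>. restrict (hist (Suc n) \<omega>) {1..n}) = hist n"
        by (auto simp: hist_def fun_eq_iff)
      ultimately have "hist n \<in> measurable (F (Suc n)) (hist_space n)" by simp
      from measurable_sets[OF this] show ?thesis
        unfolding subalgebra_def spF F_sets[of n] by auto
    qed
    show "V n \<in> borel_measurable (F n)" for n
    proof -
      have "(\<lambda>\<omega>. KL (est n (hist n \<omega>))) \<in> borel_measurable (F n)"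
        by (rule measurable_compose[OF hist_F KL_est_measurable])
      then show ?thesis unfolding V_def[abs_def] est_hist by measurable
    qed
    show "(\<integral>\<^sup>+\<omega>. V (Suc n) \<omega> * indicator H \<omega> \<partial>M) \<le> (\<integral>\<^sup>+\<omega>. V n \<omega> * indicator H \<omega> \<partial>M)"
      if "H \<in> sets (F n)" for n H
    proof -
      have "\<exists>A. H = hist n -` A \<inter> space M \<and> A \<in> sets (hist_space n)"
        using that by (simp only: F_sets mem_Collect_eq)
      then obtain A where A[measurable]: "A \<in> sets (hist_space n)" and H: "H = hist n -` A \<inter> space M"
        by blast
      have ind: "indicator H \<omega> = (indicator A (hist n \<omega>) :: ennreal)" if "\<omega> \<in> space M" for \<omega>
        using that by (simp add: H indicator_def)
      have "(\<integral>\<^sup>+\<omega>. V (Suc n) \<omega> * indicator H \<omega> \<partial>M)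
        = (\<integral>\<^sup>+\<omega>. KL (est (Suc n) (\<lambda>i. X i \<omega>)) * indicator A (hist n \<omega>)
            + ennreal (R (Suc n)) * indicator A (hist n \<omega>) \<partial>M)"
        by (intro nn_integral_cong) (simp add: ind V_def distrib_right)
      also have "\<dots> = (\<integral>\<^sup>+\<omega>. KL (est (Suc n) (\<lambda>i. X i \<omega>)) * indicator A (hist n \<omega>) \<partial>M)
          + (\<integral>\<^sup>+\<omega>. ennreal (R (Suc n)) * indicator A (hist n \<omega>) \<partial>M)"
        by (rule nn_integral_add) measurable
      also have "\<dots> \<le> (\<integral>\<^sup>+\<omega>. (KL (est n (\<lambda>i. X i \<omega>)) + ennreal (C * (w (Suc n))\<^sup>2)) * indicator A (hist n \<omega>) \<partial>M)
          + (\<integral>\<^sup>+\<omega>. ennreal (R (Suc n)) * indicator A (hist n \<omega>) \<partial>M)"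
        using KL_almost_supermartingale[OF A] by (intro add_right_mono) (simp add: C_def mult.commute)
      also have "\<dots> = (\<integral>\<^sup>+\<omega>. (KL (est n (\<lambda>i. X i \<omega>)) + ennreal (C * (w (Suc n))\<^sup>2)) * indicator A (hist n \<omega>)
          + ennreal (R (Suc n)) * indicator A (hist n \<omega>) \<partial>M)"
        by (rule nn_integral_add[symmetric]) measurable
      also have "\<dots> = (\<integral>\<^sup>+\<omega>. V n \<omega> * indicator H \<omega> \<partial>M)"
      proof (rule nn_integral_cong)
        fix \<omega> assume "\<omega> \<in> space M"
        have "ennreal (R n) = ennreal (C * (w (Suc n))\<^sup>2) + ennreal (R (Suc n))"
          using C R0[of "Suc n"] by (subst R_Suc) simp
        then show "(KL (est n (\<lambda>i. X i \<omega>)) + ennreal (C * (w (Suc n))\<^sup>2)) * indicator A (hist n \<omega>)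
          + ennreal (R (Suc n)) * indicator A (hist n \<omega>) = V n \<omega> * indicator H \<omega>"
          by (simp only: V_def ind[OF \<open>\<omega> \<in> space M\<close>] distrib_right add.assoc)
      qed
      finally show ?thesis .
    qed
    have "(\<integral>\<^sup>+\<omega>. V n \<omega> \<partial>M) = (\<integral>\<^sup>+\<omega>. KL (est n (\<lambda>i. X i \<omega>)) \<partial>M) + ennreal (R n)" for n
      unfolding V_def by (simp add: nn_integral_add M.emeasure_space_1)
    then show "(\<lambda>n. \<integral>\<^sup>+\<omega>. V n \<omega> \<partial>M) \<longlonglongrightarrow> 0"
      using tendsto_add[OF expected_KL_tendsto_0[OF w_sq w_div] R_lim] by simp
  qed
  then show ?thesis
  proof eventually_elim
    case (elim \<omega>)
    show ?case by (rule tendsto_sandwich[OF _ _ tendsto_const elim]) (simp_all add: V_def)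
  qed
qed

lemma AE_kl_error_tendsto_0:
  assumes w_sq: "summable (\<lambda>i. (w (Suc i))\<^sup>2)"
    and w_div: "filterlim (\<lambda>n. \<Sum>i<n. w (Suc i)) at_top sequentially"
  shows "AE \<omega> in M. (\<lambda>n. kl_error \<nu> (mixture \<mu> k f) (mixture \<mu> k (est n (\<lambda>i. X i \<omega>)))) \<longlonglongrightarrow> 0"
proof -
  have "AE \<omega> in M. \<forall>n. regular (est n (\<lambda>i. X i \<omega>))"
    unfolding AE_all_countable using est_regular by blast
  then show ?thesis
    using AE_KL_tendsto_0[OF w_sq w_div]
  proof eventually_elim
    case (elim \<omega>)
    have "kl_error \<nu> (mixture \<mu> k f) (mixture \<mu> k (est n (\<lambda>i. X i \<omega>))) = enn2ereal (KL (est n (\<lambda>i. X i \<omega>)))" for n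
    proof -
      have g: "prob_density_on \<mu> (est n (\<lambda>i. X i \<omega>))" using elim(1) by (simp add: regular_def)
      note d = mixture_density[OF f_density] mixture_density[OF g]
      show ?thesis
        by (rule kl_error_eq_gen_kl)
          (auto intro: mixture_pos_AE f_density g prob_density_onD[OF d(1)] prob_density_onD[OF d(2)])
    qed
    moreover have "(\<lambda>n. enn2ereal (KL (est n (\<lambda>i. X i \<omega>)))) \<longlonglongrightarrow> 0"
      using tendsto_enn2erealI[OF elim(2)] unfolding zero_ennreal.rep_eq .
    ultimately show ?case by simp
  qed
qed

end

text \<open>Square summability puts all but finitely many weights below \<open>1 / 2\<close>; the remaining ones have
  a maximum below \<open>1\<close>.\<close>

lemma weights_bounded_away_from_1:
  fixes w :: "nat \<Rightarrow> real"
  assumes range: "\<And>i. i \<ge> 1 \<Longrightarrow> 0 < w i \<and> w i < 1" and sq: "summable (\<lambda>i. (w (Suc i))\<^sup>2)"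
  obtains \<delta> where "0 < \<delta>" "\<And>i. i \<ge> 1 \<Longrightarrow> w i \<le> 1 - \<delta>"
proof -
  have "(\<lambda>i. (w (Suc i))\<^sup>2) \<longlonglongrightarrow> 0" by (rule summable_LIMSEQ_zero[OF sq])
  then have "\<forall>\<^sub>F i in sequentially. (w (Suc i))\<^sup>2 < (1 / 2)\<^sup>2" by (rule order_tendstoD) simp
  then obtain N where N: "\<And>i. i \<ge> N \<Longrightarrow> (w (Suc i))\<^sup>2 < (1 / 2)\<^sup>2" by (auto simp: eventually_sequentially)
  define \<delta> where "\<delta> = Min (insert (1 / 2) ((\<lambda>i. 1 - w i) ` {1..N}))"
  have "0 < \<delta>" unfolding \<delta>_def using range by (subst Min_gr_iff) auto
  moreover have "w i \<le> 1 - \<delta>" if "i \<ge> 1" for i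
  proof (cases "i \<le> N")
    case True
    then have "\<delta> \<le> 1 - w i" unfolding \<delta>_def using that by (intro Min_le) auto
    then show ?thesis by simp
  next
    case False
    then have "(w i)\<^sup>2 < (1 / 2)\<^sup>2" using N[of "i - 1"] that by simp
    then have "w i < 1 / 2" by (rule power_less_imp_less_base) simp
    moreover have "\<delta> \<le> 1 / 2" unfolding \<delta>_def by (intro Min_le) auto
    ultimately show ?thesis by linarith
  qed
  ultimately show ?thesis by (rule that)
qed

theorem theorem2:
  fixes M :: "'a measure"
    and \<nu> :: "'x measure"
    and \<mu> :: "'t measure"
    and k :: "'x \<Rightarrow> 't \<Rightarrow> real"
    and f f0 :: "'t \<Rightarrow> real"
    and w :: "nat \<Rightarrow> real"
    and X :: "nat \<Rightarrow> 'a \<Rightarrow> 'x"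
  assumes "prob_space M"
    and "sigma_finite_measure \<nu>"
    and "sigma_finite_measure \<mu>"
    and k_measurable: "(\<lambda>(x, \<theta>). k x \<theta>) \<in> borel_measurable (\<nu> \<Otimes>\<^sub>M \<mu>)"
    and k_density: "\<And>\<theta>. \<theta> \<in> space \<mu> \<Longrightarrow> prob_density_on \<nu> (\<lambda>x. k x \<theta>)"
    and f_density: "prob_density_on \<mu> f"
    and X_indep: "prob_space.indep_vars M (\<lambda>_. \<nu>) X {1..}"
    and X_distr: "\<And>i. i \<ge> 1 \<Longrightarrow> distributed M \<nu> (X i) (\<lambda>x. ennreal (mixture \<mu> k f x))"
    and f0_density: "prob_density_on \<mu> f0"
    and f0_support: "AE \<theta> in \<mu>. 0 < f \<theta> \<longrightarrow> 0 < f0 \<theta>"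
    and w_range: "\<And>i. i \<ge> 1 \<Longrightarrow> 0 < w i \<and> w i < 1"
    and A1_div: "filterlim (\<lambda>n. \<Sum>i=1..n. w i) at_top sequentially"
    and A1_sq: "summable (\<lambda>i. (w (Suc i))\<^sup>2)"
    and A5: "\<exists>B::real. \<forall>\<theta>1\<in>space \<mu>. \<forall>\<theta>2\<in>space \<mu>. \<forall>\<theta>3\<in>space \<mu>.
        (\<integral>\<^sup>+x. (ennreal (k x \<theta>1) / ennreal (k x \<theta>2))\<^sup>2 * ennreal (k x \<theta>3) \<partial>\<nu>) < ennreal B"
  shows "AE \<omega> in M.
    (\<lambda>n. kl_error \<nu> (mixture \<mu> k f)
           (mixture \<mu> k (recursive_estimate \<mu> k w f0 (\<lambda>i. X i \<omega>) n))) \<longlonglongrightarrow> 0"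
proof -
  obtain B0 :: real where B0: "\<forall>\<theta>1\<in>space \<mu>. \<forall>\<theta>2\<in>space \<mu>. \<forall>\<theta>3\<in>space \<mu>.
      (\<integral>\<^sup>+x. (ennreal (k x \<theta>1) / ennreal (k x \<theta>2))\<^sup>2 * ennreal (k x \<theta>3) \<partial>\<nu>) < ennreal B0"
    using A5 by blast
  \<comment> \<open>the largest weight is less than \<open>1\<close>, so a single \<open>\<delta>\<close> serves in all steps\<close>
  obtain \<delta> where \<delta>: "0 < \<delta>" "\<And>i. i \<ge> 1 \<Longrightarrow> w i \<le> 1 - \<delta>"
    using weights_bounded_away_from_1[OF w_range A1_sq] by blast
  have ratio_moment: "(\<integral>\<^sup>+x. (ennreal (k x \<theta>1) / ennreal (k x \<theta>2))\<^sup>2 * ennreal (k x \<theta>3) \<partial>\<nu>)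
      \<le> ennreal (max 0 B0)"
    if "\<theta>1 \<in> space \<mu>" "\<theta>2 \<in> space \<mu>" "\<theta>3 \<in> space \<mu>" for \<theta>1 \<theta>2 \<theta>3
  proof -
    have "ennreal B0 \<le> ennreal (max 0 B0)" by (rule ennreal_leI) simp
    then show ?thesis using B0 that by (meson less_imp_le order_trans)
  qed
  interpret prob_space M by fact
  interpret predictive_recursion \<nu> \<mu> k "max 0 B0" M f f0 w X \<delta>
  proof (intro predictive_recursion.intro mixture_kernel.intro predictive_recursion_axioms.intro)
    show "prob_space M" "sigma_finite_measure \<nu>" "sigma_finite_measure \<mu>" by fact+
    show "(\<lambda>(x, \<theta>). k x \<theta>) \<in> borel_measurable (\<nu> \<Otimes>\<^sub>M \<mu>)" by (rule k_measurable)
    show "prob_density_on \<nu> (\<lambda>x. k x \<theta>)" if "\<theta> \<in> space \<mu>" for \<theta> using that by (rule k_density)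
    show "0 \<le> max 0 B0" by simp
    show "(\<integral>\<^sup>+x. (ennreal (k x \<theta>1) / ennreal (k x \<theta>2))\<^sup>2 * ennreal (k x \<theta>3) \<partial>\<nu>) \<le> ennreal (max 0 B0)"
      if "\<theta>1 \<in> space \<mu>" "\<theta>2 \<in> space \<mu>" "\<theta>3 \<in> space \<mu>" for \<theta>1 \<theta>2 \<theta>3
      using that by (rule ratio_moment)
    show "prob_density_on \<mu> f" "prob_density_on \<mu> f0" by fact+
    show "AE \<theta> in \<mu>. 0 < f \<theta> \<longrightarrow> 0 < f0 \<theta>" by (rule f0_support)
    show "indep_vars (\<lambda>_. \<nu>) X {1..}" by (rule X_indep)
    show "distr M \<nu> (X i) = density \<nu> (\<lambda>x. ennreal (mixture \<mu> k f x))" if "i \<ge> 1" for i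
      by (rule distributed_distr_eq_density[OF X_distr[OF that]])
    show "0 < \<delta>" by (rule \<delta>(1))
    show "0 \<le> w i" if "i \<ge> 1" for i using w_range[OF that] by simp
    show "w i \<le> 1 - \<delta>" if "i \<ge> 1" for i using that by (rule \<delta>(2))
  qed
  have "(\<lambda>n. \<Sum>i=1..n. w i) = (\<lambda>n. \<Sum>i<n. w (Suc i))"
    by (simp add: sum.atLeast1_atMost_eq)
  then show ?thesis
    using AE_kl_error_tendsto_0[OF A1_sq] A1_div by simp
qed

end
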